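(* Let $\mathbf{S}$ be an orthodox semigroup, and let $n\in\mathbb{N}$. Then $\mathbf{S}$ is $n$-supernilpotent if and only if $\mathbf{S}$ is isomorphic to a direct product of an $n$-nilpotent group and a rectangular band.
   Context: $\mathbb{N}$ is the set of positive integers. A semigroup $\mathbf{S}$ is regular if for every $x\in S$ there is $y\in S$ with $xyx=x$. A regular semigroup is orthodox if its set of idempotents $E(S)=\{a\in S: a^2=a\}$ is a subsemigroup. A rectangular band is a semigroup isomorphic to $L\times R$, where $L,R$ are nonempty sets and $(l_1,r_1)(l_2,r_2)=(l_1,r_2)$ (i.e. a direct product of a left zero semigroup and a right zero semigroup). Commutators. Let $\mathbf{A}$ be an algebra, $\operatorname{Con}(\mathbf{A})$ its congruence lattice with least element $0_A$ (equality) and greatest element $1_A=A\times A$, and $\operatorname{Pol}(\mathbf{A})$ its set of polynomial operations (operations built from the basic operations, variables and constants from $A$; for a semigroup, products of variables and constants). For tuples, $\mathbf{x}\;\alpha\;\mathbf{y}$ means coordinatewise relatedness. For $k\ge 1$ and $\alpha_1,\dots,\alpha_k,\beta,\delta\in\operatorname{Con}(\mathbf{A})$, the condition $C(\alpha_1,\dots,\alpha_k,\beta;\delta)$ means: for all $n_1,\dots,n_k,m\in\mathbb{N}$, every $p\in\operatorname{Pol}(\mathbf{A})$ of arity $n_1+\dots+n_k+m$, and all $\mathbf{a}_j,\mathbf{b}_j\in A^{n_j}$ with $\mathbf{a}_j\;\alpha_j\;\mathbf{b}_j$ ($j=1,\dots,k$) and $\mathbf{c},\mathbf{d}\in A^m$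 with $\mathbf{c}\;\beta\;\mathbf{d}$: if $p(\mathbf{x}_1,\dots,\mathbf{x}_k,\mathbf{c})\;\delta\;p(\mathbf{x}_1,\dots,\mathbf{x}_k,\mathbf{d})$ for all choices $\mathbf{x}_j\in\{\mathbf{a}_j,\mathbf{b}_j\}$ other than the choice $(\mathbf{x}_1,\dots,\mathbf{x}_k)=(\mathbf{b}_1,\dots,\mathbf{b}_k)$, then $p(\mathbf{b}_1,\dots,\mathbf{b}_k,\mathbf{c})\;\delta\;p(\mathbf{b}_1,\dots,\mathbf{b}_k,\mathbf{d})$. For $k\ge 2$, the $k$-ary commutator $[\alpha_1,\dots,\alpha_k]$ is the smallest congruence $\delta$ with $C(\alpha_1,\dots,\alpha_k;\delta)$ (with $\alpha_k$ in the role of $\beta$). An algebra $\mathbf{A}$ is $n$-supernilpotent if $[\,\underbrace{1_A,\dots,1_A}_{n+1}\,]=0_A$. Put $(1_A,1_A]^{(1)}=[1_A,1_A]$ and $(1_A,1_A]^{(k+1)}=[1_A,(1_A,1_A]^{(k)}]$; $\mathbf{A}$ is $n$-nilpotent if $(1_A,1_A]^{(n)}=0_A$. For groups, $n$-nilpotent means nilpotent of class at most $n$ in the usual sense. *)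

theory Defs
  imports "HOL-Algebra.Generated_Groups"
begin

section \<open>Semigroups\<close>

text \<open>
  A semigroup is an object of the \<open>monoid\<close> record type of which only the carrier and the
  multiplication are used, so that the library's \<open>iso\<close>, \<open>\<cong>\<close> and \<open>\<times>\<times>\<close> apply. The field
  \<open>one\<close> is arbitrary and unconstrained (\<open>\<cong>\<close> does not refer to it).
\<close>

locale semigroup_struct =
  fixes S (structure)
  assumes carrier_nonempty: "carrier S \<noteq> {}"
    and mult_closed: "\<lbrakk>x \<in> carrier S; y \<in> carrier S\<rbrakk> \<Longrightarrow> x \<otimes> y \<in> carrier S"
    and mult_assoc: "\<lbrakk>x \<in> carrier S; y \<in> carrier S; z \<in> carrier S\<rbrakk>
      \<Longrightarrow> (x \<otimes> y) \<otimes> z = x \<otimes> (y \<otimes> z)"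

locale regular_semigroup = semigroup_struct +
  assumes regular: "x \<in> carrier S \<Longrightarrow> \<exists>y\<in>carrier S. x \<otimes> y \<otimes> x = x"

definition idempotents :: "('a, 'm) monoid_scheme \<Rightarrow> 'a set" where
  "idempotents S = {a \<in> carrier S. a \<otimes>\<^bsub>S\<^esub> a = a}"

locale orthodox_semigroup = regular_semigroup +
  assumes idempotents_closed:
    "\<lbrakk>e \<in> idempotents S; f \<in> idempotents S\<rbrakk> \<Longrightarrow> e \<otimes> f \<in> idempotents S"

definition band_product :: "'l set \<Rightarrow> 'r set \<Rightarrow> ('l \<times> 'r) monoid" where
  "band_product L R =
     \<lparr>carrier = L \<times> R, mult = (\<lambda>(l1, r1) (l2, r2). (l1, r2)), one = undefined\<rparr>"

text \<open>
  Taking \<open>L\<close> and \<open>R\<close> inside the type of \<open>B\<close> is no restriction, see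
  \<open>rectangular_band_if_iso_band_product\<close> below.
\<close>
definition rectangular_band :: "('a, 'm) monoid_scheme \<Rightarrow> bool" where
  "rectangular_band B \<longleftrightarrow>
     (\<exists>(L :: 'a set) (R :: 'a set). L \<noteq> {} \<and> R \<noteq> {} \<and> B \<cong> band_product L R)"


section \<open>Congruences, polynomials and higher commutators\<close>

definition congruences :: "('a, 'm) monoid_scheme \<Rightarrow> ('a \<times> 'a) set set" where
  "congruences S = {\<theta>. equiv (carrier S) \<theta> \<and>
     (\<forall>x x' y y'. (x, x') \<in> \<theta> \<longrightarrow> (y, y') \<in> \<theta> \<longrightarrow> (x \<otimes>\<^bsub>S\<^esub> y, x' \<otimes>\<^bsub>S\<^esub> y') \<in> \<theta>)}"

definition zero_cong :: "('a, 'm) monoid_scheme \<Rightarrow> ('a \<times> 'a) set" where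
  "zero_cong S = Id_on (carrier S)"

definition one_cong :: "('a, 'm) monoid_scheme \<Rightarrow> ('a \<times> 'a) set" where
  "one_cong S = carrier S \<times> carrier S"

text \<open>
  Polynomial operations of arity \<open>N\<close>. An argument tuple is a list; only the values on lists of
  length \<open>N\<close> over the carrier are meaningful.
\<close>
inductive_set polynomials :: "('a, 'm) monoid_scheme \<Rightarrow> nat \<Rightarrow> ('a list \<Rightarrow> 'a) set"
  for S :: "('a, 'm) monoid_scheme" and N :: nat where
  Var: "i < N \<Longrightarrow> (\<lambda>x. x ! i) \<in> polynomials S N"
| Const: "a \<in> carrier S \<Longrightarrow> (\<lambda>x. a) \<in> polynomials S N"
| Mult: "\<lbrakk>p \<in> polynomials S N; q \<in> polynomials S N\<rbrakk>
    \<Longrightarrow> (\<lambda>x. p x \<otimes>\<^bsub>S\<^esub> q x) \<in> polynomials S N"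

definition related_tuples :: "('a \<times> 'a) set \<Rightarrow> 'a list \<Rightarrow> 'a list \<Rightarrow> bool" where
  "related_tuples \<alpha> x y \<longleftrightarrow> list_all2 (\<lambda>u v. (u, v) \<in> \<alpha>) x y"

text \<open>
  A choice of \<open>x\<^sub>j \<in> {a\<^sub>j, b\<^sub>j}\<close> for \<open>j = 1, \<dots>, k\<close> is given by the set \<open>J\<close> of those indices
  (counted from 0) at which \<open>b\<^sub>j\<close> is chosen. The result is the concatenated tuple.
\<close>
definition choose_tuples :: "nat set \<Rightarrow> 'a list list \<Rightarrow> 'a list list \<Rightarrow> 'a list" where
  "choose_tuples J as bs =
     concat (map (\<lambda>j. if j \<in> J then bs ! j else as ! j) [0..<length as])"

text \<open>
  \<open>centralizes S \<alpha>s \<beta> \<delta>\<close> is the condition $C(\alpha_1,\dots,\alpha_k,\beta;\delta)$ with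
  \<open>\<alpha>s = [\<alpha>\<^sub>1, \<dots>, \<alpha>\<^sub>k]\<close>. The choices other than \<open>(b\<^sub>1, \<dots>, b\<^sub>k)\<close> are the proper subsets
  \<open>J\<close> of the index set: the choice of \<open>a\<^sub>j\<close> counts as different from that of \<open>b\<^sub>j\<close> even if the
  tuples \<open>a\<^sub>j\<close> and \<open>b\<^sub>j\<close> happen to coincide. (Otherwise \<open>as = bs\<close> would make the premise
  vacuous and force \<open>\<beta> \<subseteq> \<delta>\<close>.)
\<close>
definition centralizes ::
  "('a, 'm) monoid_scheme \<Rightarrow> ('a \<times> 'a) set list \<Rightarrow> ('a \<times> 'a) set \<Rightarrow> ('a \<times> 'a) set \<Rightarrow> bool" where
  "centralizes S \<alpha>s \<beta> \<delta> \<longleftrightarrow>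
     (\<forall>ns m p as bs c d.
        length ns = length \<alpha>s \<longrightarrow> (\<forall>j<length \<alpha>s. 1 \<le> ns ! j) \<longrightarrow> 1 \<le> m \<longrightarrow>
        p \<in> polynomials S (sum_list ns + m) \<longrightarrow>
        length as = length \<alpha>s \<longrightarrow> length bs = length \<alpha>s \<longrightarrow>
        (\<forall>j<length \<alpha>s. length (as ! j) = ns ! j \<and> length (bs ! j) = ns ! j \<and>
           related_tuples (\<alpha>s ! j) (as ! j) (bs ! j)) \<longrightarrow>
        length c = m \<longrightarrow> length d = m \<longrightarrow> related_tuples \<beta> c d \<longrightarrow>
        (\<forall>J. J \<subset> {..<length \<alpha>s} \<longrightarrow>
           (p (choose_tuples J as bs @ c), p (choose_tuples J as bs @ d)) \<in> \<delta>) \<longrightarrow>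
        (p (concat bs @ c), p (concat bs @ d)) \<in> \<delta>)"

text \<open>
  The commutator of a list of at least two congruences, whose last entry plays the role of
  \<open>\<beta>\<close>. \<open>LEAST\<close> is taken with respect to inclusion; see \<open>commutator_least\<close> for existence.
\<close>
definition commutator ::
  "('a, 'm) monoid_scheme \<Rightarrow> ('a \<times> 'a) set list \<Rightarrow> ('a \<times> 'a) set" where
  "commutator S \<alpha>s =
     (LEAST \<delta>. \<delta> \<in> congruences S \<and> centralizes S (butlast \<alpha>s) (last \<alpha>s) \<delta>)"

definition supernilpotent :: "('a, 'm) monoid_scheme \<Rightarrow> nat \<Rightarrow> bool" where
  "supernilpotent S n \<longleftrightarrow> commutator S (replicate (n + 1) (one_cong S)) = zero_cong S"


section \<open>Nilpotent groups\<close>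

text \<open>
  The lower central series with index shifted: \<open>lower_central G k\<close> is the subgroup usually
  written $\gamma_{k+1}(G)$, so class at most \<open>n\<close> means that \<open>lower_central G n\<close> is trivial.
\<close>
primrec lower_central :: "('a, 'm) monoid_scheme \<Rightarrow> nat \<Rightarrow> 'a set" where
  "lower_central G 0 = carrier G"
| "lower_central G (Suc k) = generate G
     {x \<otimes>\<^bsub>G\<^esub> y \<otimes>\<^bsub>G\<^esub> inv\<^bsub>G\<^esub> x \<otimes>\<^bsub>G\<^esub> inv\<^bsub>G\<^esub> y | x y. x \<in> carrier G \<and> y \<in> lower_central G k}"

definition nilpotent_group :: "('a, 'm) monoid_scheme \<Rightarrow> nat \<Rightarrow> bool" where
  "nilpotent_group G n \<longleftrightarrow> group G \<and> lower_central G n = {\<one>\<^bsub>G\<^esub>}"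


section \<open>Well-definedness of the commutator\<close>

lemma polynomials_closed:
  assumes "semigroup_struct S" "p \<in> polynomials S N" "set x \<subseteq> carrier S" "length x = N"
  shows "p x \<in> carrier S"
  using assms(2)
proof induction
  case (Var i)
  then show ?case using assms(3,4) nth_mem by blast
next
  case (Mult p q)
  then show ?case using semigroup_struct.mult_closed[OF assms(1)] by blast
qed

lemma related_tuples_carrier:
  assumes "related_tuples \<alpha> x y" "\<alpha> \<subseteq> A \<times> A"
  shows "set x \<subseteq> A" "set y \<subseteq> A"
  using assms unfolding related_tuples_def
  by (force simp: list_all2_conv_all_nth in_set_conv_nth)+

lemma centralizes_one_cong:
  assumes S: "semigroup_struct S" and \<alpha>: "set \<alpha>s \<subseteq> congruences S" and \<beta>: "\<beta> \<in> congruences S"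
  shows "centralizes S \<alpha>s \<beta> (one_cong S)"
  unfolding centralizes_def one_cong_def
proof (intro allI impI)
  fix ns m p and as bs :: "'a list list" and c d
  assume ns: "length ns = length \<alpha>s" and p: "p \<in> polynomials S (sum_list ns + m)"
    and len: "length as = length \<alpha>s" "length bs = length \<alpha>s"
    and ab: "\<forall>j<length \<alpha>s. length (as ! j) = ns ! j \<and> length (bs ! j) = ns ! j \<and>
           related_tuples (\<alpha>s ! j) (as ! j) (bs ! j)"
    and cd: "length c = m" "length d = m" "related_tuples \<beta> c d"
  have sub: "\<theta> \<subseteq> carrier S \<times> carrier S" if "\<theta> \<in> congruences S" for \<theta>
    using that unfolding congruences_def equiv_def by blast
  have "map length bs = ns"
    using ns len ab by (intro nth_equalityI) auto
  then have 1: "length (concat bs) = sum_list ns"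
    by (simp add: length_concat)
  have "set (bs ! j) \<subseteq> carrier S" if "j < length \<alpha>s" for j
    using related_tuples_carrier(2)[of "\<alpha>s ! j" "as ! j" "bs ! j" "carrier S"] ab that \<alpha> sub nth_mem
    by blast
  then have 2: "set (concat bs) \<subseteq> carrier S"
    using len(2) by (fastforce simp: in_set_conv_nth)
  have 3: "set c \<subseteq> carrier S" "set d \<subseteq> carrier S"
    using related_tuples_carrier[OF cd(3) sub[OF \<beta>]] by auto
  show "(p (concat bs @ c), p (concat bs @ d)) \<in> carrier S \<times> carrier S"
    using polynomials_closed[OF S p, of "concat bs @ c"] polynomials_closed[OF S p, of "concat bs @ d"]
      1 2 3 cd by auto
qed

lemma one_cong_congruence:
  assumes "semigroup_struct S"
  shows "one_cong S \<in> congruences S"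
  using semigroup_struct.mult_closed[OF assms]
  by (auto simp: congruences_def one_cong_def equiv_def refl_on_def sym_def trans_def)

lemma commutator_least:
  assumes S: "semigroup_struct S" and \<alpha>: "set \<alpha>s \<subseteq> congruences S" and ne: "\<alpha>s \<noteq> []"
  shows "commutator S \<alpha>s \<in> congruences S"
    and "centralizes S (butlast \<alpha>s) (last \<alpha>s) (commutator S \<alpha>s)"
    and "\<lbrakk>\<delta> \<in> congruences S; centralizes S (butlast \<alpha>s) (last \<alpha>s) \<delta>\<rbrakk> \<Longrightarrow> commutator S \<alpha>s \<subseteq> \<delta>"
proof -
  define P where "P = (\<lambda>\<delta>. \<delta> \<in> congruences S \<and> centralizes S (butlast \<alpha>s) (last \<alpha>s) \<delta>)"
  have one: "P (one_cong S)"
    unfolding P_def using S \<alpha> ne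
    by (meson centralizes_one_cong in_set_butlastD last_in_set one_cong_congruence subset_code(1))
  have "\<Inter>{\<delta>. P \<delta>} \<in> congruences S"
  proof -
    have eq: "equiv (carrier S) \<delta>" if "P \<delta>" for \<delta>
      using that by (simp add: P_def congruences_def)
    have "equiv (carrier S) (\<Inter>{\<delta>. P \<delta>})"
    proof (rule equivI)
      show "\<Inter>{\<delta>. P \<delta>} \<subseteq> carrier S \<times> carrier S"
        using one by (auto simp: one_cong_def)
      show "refl_on (carrier S) (\<Inter>{\<delta>. P \<delta>})"
        using eq by (auto simp: equiv_def refl_on_def)
      show "sym (\<Inter>{\<delta>. P \<delta>})"
        using eq unfolding equiv_def sym_def by blast
      show "trans (\<Inter>{\<delta>. P \<delta>})"
        using eq unfolding equiv_def trans_def by blast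
    qed
    then show ?thesis
      unfolding congruences_def P_def by blast
  qed
  moreover have "centralizes S (butlast \<alpha>s) (last \<alpha>s) (\<Inter>{\<delta>. P \<delta>})"
    unfolding centralizes_def
  proof (intro allI impI InterI)
    fix ns m p as bs c d \<delta>
    assume H: "length ns = length (butlast \<alpha>s)" "\<forall>j<length (butlast \<alpha>s). 1 \<le> ns ! j" "1 \<le> m"
      "p \<in> polynomials S (sum_list ns + m)"
      "length as = length (butlast \<alpha>s)" "length bs = length (butlast \<alpha>s)"
      "\<forall>j<length (butlast \<alpha>s). length (as ! j) = ns ! j \<and> length (bs ! j) = ns ! j \<and>
           related_tuples (butlast \<alpha>s ! j) (as ! j) (bs ! j)"
      "length c = m" "length d = m" "related_tuples (last \<alpha>s) c d"
      and J: "\<forall>J. J \<subset> {..<length (butlast \<alpha>s)} \<longrightarrow>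
           (p (choose_tuples J as bs @ c), p (choose_tuples J as bs @ d)) \<in> \<Inter>{\<delta>. P \<delta>}"
      and \<delta>: "\<delta> \<in> {\<delta>. P \<delta>}"
    have J': "\<forall>J. J \<subset> {..<length (butlast \<alpha>s)} \<longrightarrow>
           (p (choose_tuples J as bs @ c), p (choose_tuples J as bs @ d)) \<in> \<delta>"
      using J \<delta> by blast
    have "centralizes S (butlast \<alpha>s) (last \<alpha>s) \<delta>"
      using \<delta> by (simp add: P_def)
    note this[unfolded centralizes_def, THEN spec, THEN spec, THEN spec, THEN spec, THEN spec,
        THEN spec, THEN spec, THEN mp, OF H(1), THEN mp, OF H(2), THEN mp, OF H(3), THEN mp, OF H(4),
        THEN mp, OF H(5), THEN mp, OF H(6), THEN mp, OF H(7), THEN mp, OF H(8), THEN mp, OF H(9),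
        THEN mp, OF H(10), THEN mp, OF J']
    then show "(p (concat bs @ c), p (concat bs @ d)) \<in> \<delta>" .
  qed
  ultimately have "P (\<Inter>{\<delta>. P \<delta>})"
    by (simp add: P_def)
  moreover have "(LEAST \<delta>. P \<delta>) = \<Inter>{\<delta>. P \<delta>}"
    using \<open>P (\<Inter>{\<delta>. P \<delta>})\<close> by (intro Least_equality) auto
  ultimately have *: "P (commutator S \<alpha>s)" "commutator S \<alpha>s = \<Inter>{\<delta>. P \<delta>}"
    by (simp_all add: commutator_def P_def)
  then show "commutator S \<alpha>s \<in> congruences S"
    and "centralizes S (butlast \<alpha>s) (last \<alpha>s) (commutator S \<alpha>s)"
    by (simp_all add: P_def)
  show "commutator S \<alpha>s \<subseteq> \<delta>"
    if "\<delta> \<in> congruences S" "centralizes S (butlast \<alpha>s) (last \<alpha>s) \<delta>"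
    using *(2) that by (auto simp: P_def)
qed


section \<open>Factors may be taken over the type of the semigroup\<close>

lemma transport_structure:
  fixes f :: "'g \<Rightarrow> 'a" and G :: "('g, 'm) monoid_scheme"
  assumes inj: "inj_on f (carrier G)"
    and closed: "\<And>x y. \<lbrakk>x \<in> carrier G; y \<in> carrier G\<rbrakk> \<Longrightarrow> x \<otimes>\<^bsub>G\<^esub> y \<in> carrier G"
  shows "\<exists>H :: 'a monoid. f \<in> iso G H \<and> \<one>\<^bsub>H\<^esub> = f \<one>\<^bsub>G\<^esub>"
proof -
  let ?g = "inv_into (carrier G) f"
  let ?H = "\<lparr>carrier = f ` carrier G, mult = (\<lambda>x y. f (?g x \<otimes>\<^bsub>G\<^esub> ?g y)), one = f \<one>\<^bsub>G\<^esub>\<rparr>"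
  have "f \<in> iso G ?H"
    using inj by (auto simp: iso_def hom_def bij_betw_def)
  then show ?thesis by (intro exI[of _ ?H]) simp
qed

lemma inverse_iso:
  assumes h: "h \<in> iso G H" and closed: "\<And>x y. \<lbrakk>x \<in> carrier G; y \<in> carrier G\<rbrakk> \<Longrightarrow> x \<otimes>\<^bsub>G\<^esub> y \<in> carrier G"
  shows "inv_into (carrier G) h \<in> iso H G"
proof -
  let ?g = "inv_into (carrier G) h"
  have b: "bij_betw h (carrier G) (carrier H)" and hh: "h \<in> hom G H"
    using h by (auto simp: iso_def)
  have bg: "bij_betw ?g (carrier H) (carrier G)"
    by (rule bij_betw_inv_into[OF b])
  have "?g (x \<otimes>\<^bsub>H\<^esub> y) = ?g x \<otimes>\<^bsub>G\<^esub> ?g y" if "x \<in> carrier H" "y \<in> carrier H" for x y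
  proof -
    have g: "?g x \<in> carrier G" "?g y \<in> carrier G" "h (?g x) = x" "h (?g y) = y"
      using that bg b by (auto simp: bij_betw_apply bij_betw_inv_into_right)
    then have "h (?g x \<otimes>\<^bsub>G\<^esub> ?g y) = x \<otimes>\<^bsub>H\<^esub> y"
      using hom_mult[OF hh] by simp
    then show ?thesis
      using g closed b by (metis bij_betw_inv_into_left)
  qed
  then show ?thesis
    using bg by (auto simp: iso_def hom_def bij_betw_apply)
qed

lemma band_product_transport:
  assumes "inj_on f L" "inj_on g R"
  shows "map_prod f g \<in> iso (band_product L R) (band_product (f ` L) (g ` R))"
  using assms by (auto simp: iso_def hom_def band_product_def bij_betw_def inj_on_def image_iff)

lemma rectangular_band_if_iso_band_product:
  fixes B :: "('a, 'm) monoid_scheme" and L :: "'l set" and R :: "'r set"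
  assumes "L \<noteq> {}" "R \<noteq> {}" "B \<cong> band_product L R"
  shows "rectangular_band B"
proof -
  obtain h where h: "h \<in> iso B (band_product L R)"
    using assms(3) by (auto simp: is_iso_def)
  then have b: "bij_betw h (carrier B) (L \<times> R)"
    by (simp add: iso_def band_product_def)
  obtain l0 r0 where lr: "l0 \<in> L" "r0 \<in> R" using assms by blast
  let ?k = "inv_into (carrier B) h"
  have k: "inj_on ?k (L \<times> R)"
    using bij_betw_inv_into[OF b] by (simp add: bij_betw_def)
  have f: "inj_on (\<lambda>l. ?k (l, r0)) L" and g: "inj_on (\<lambda>r. ?k (l0, r)) R"
    using inj_onD[OF k] lr by (auto intro!: inj_onI)
  show ?thesis
    unfolding rectangular_band_def
    using iso_set_trans[OF h band_product_transport[OF f g]] assms(1,2)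
    by (intro exI[of _ "(\<lambda>l. ?k (l, r0)) ` L"] exI[of _ "(\<lambda>r. ?k (l0, r)) ` R"])
      (auto simp: is_iso_def)
qed

lemma lower_central_in_carrier:
  assumes "group G"
  shows "lower_central G k \<subseteq> carrier G"
proof (induction k)
  case (Suc k)
  interpret group G by fact
  show ?case
    unfolding lower_central.simps by (rule generate_incl) (use Suc in auto)
qed simp

lemma lower_central_image:
  assumes f: "f \<in> iso G H" and G: "group G" and H: "group H"
  shows "lower_central H k = f ` lower_central G k"
proof (induction k)
  case 0
  then show ?case using f by (simp add: iso_iff)
next
  case (Suc k)
  interpret group_hom G H f
    using f G H by (simp add: group_hom_def group_hom_axioms_def iso_def)
  let ?X = "{x \<otimes>\<^bsub>G\<^esub> y \<otimes>\<^bsub>G\<^esub> inv\<^bsub>G\<^esub> x \<otimes>\<^bsub>G\<^esub> inv\<^bsub>G\<^esub> y | x y. x \<in> carrier G \<and> y \<in> lower_central G k}"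
  let ?Y = "{x \<otimes>\<^bsub>H\<^esub> y \<otimes>\<^bsub>H\<^esub> inv\<^bsub>H\<^esub> x \<otimes>\<^bsub>H\<^esub> inv\<^bsub>H\<^esub> y | x y. x \<in> carrier H \<and> y \<in> lower_central H k}"
  note lc = lower_central_in_carrier[OF G, of k]
  have surj: "carrier H = f ` carrier G"
    using f by (auto simp: iso_def bij_betw_def)
  have comm: "f (x \<otimes>\<^bsub>G\<^esub> y \<otimes>\<^bsub>G\<^esub> inv\<^bsub>G\<^esub> x \<otimes>\<^bsub>G\<^esub> inv\<^bsub>G\<^esub> y) =
      f x \<otimes>\<^bsub>H\<^esub> f y \<otimes>\<^bsub>H\<^esub> inv\<^bsub>H\<^esub> (f x) \<otimes>\<^bsub>H\<^esub> inv\<^bsub>H\<^esub> (f y)"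
    if "x \<in> carrier G" "y \<in> carrier G" for x y
    using that by simp
  have "?Y = f ` ?X"
  proof (intro subset_antisym subsetI)
    fix z assume "z \<in> ?Y"
    then obtain x y where "x \<in> carrier G" "y \<in> lower_central G k"
      "z = f x \<otimes>\<^bsub>H\<^esub> f y \<otimes>\<^bsub>H\<^esub> inv\<^bsub>H\<^esub> (f x) \<otimes>\<^bsub>H\<^esub> inv\<^bsub>H\<^esub> (f y)"
      unfolding Suc surj by blast
    moreover from this have "z = f (x \<otimes>\<^bsub>G\<^esub> y \<otimes>\<^bsub>G\<^esub> inv\<^bsub>G\<^esub> x \<otimes>\<^bsub>G\<^esub> inv\<^bsub>G\<^esub> y)"
      using comm[of x y] lc by auto
    ultimately show "z \<in> f ` ?X" by blast
  next
    fix z assume "z \<in> f ` ?X"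
    then obtain x y where "x \<in> carrier G" "y \<in> lower_central G k"
      "z = f (x \<otimes>\<^bsub>G\<^esub> y \<otimes>\<^bsub>G\<^esub> inv\<^bsub>G\<^esub> x \<otimes>\<^bsub>G\<^esub> inv\<^bsub>G\<^esub> y)"
      by blast
    moreover from this have
      "z = f x \<otimes>\<^bsub>H\<^esub> f y \<otimes>\<^bsub>H\<^esub> inv\<^bsub>H\<^esub> (f x) \<otimes>\<^bsub>H\<^esub> inv\<^bsub>H\<^esub> (f y)"
      using comm[of x y] lc by auto
    ultimately show "z \<in> ?Y"
      unfolding Suc surj by blast
  qed
  moreover have "?X \<subseteq> carrier G" using lc by auto
  ultimately show ?case
    using generate_img[of ?X] by simp
qed

text \<open>
  A decomposition with factors over arbitrary types yields one with factors over the type of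
  \<open>S\<close>.
\<close>
lemma factors_over_own_type:
  fixes S :: "('a, 's) monoid_scheme" and G :: "('g, 'm) monoid_scheme"
    and B :: "('b, 'n) monoid_scheme"
  assumes S: "semigroup_struct S"
    and G: "nilpotent_group G n" and B: "rectangular_band B" and iso: "S \<cong> G \<times>\<times> B"
  shows "\<exists>(G' :: 'a monoid) (B' :: 'a monoid).
    nilpotent_group G' n \<and> rectangular_band B' \<and> S \<cong> G' \<times>\<times> B'"
proof -
  interpret G: group G using G by (simp add: nilpotent_group_def)
  obtain h where h: "h \<in> iso S (G \<times>\<times> B)"
    using iso by (auto simp: is_iso_def)
  then have hb: "bij_betw h (carrier S) (carrier G \<times> carrier B)" and hh: "h \<in> hom S (G \<times>\<times> B)"
    by (auto simp: iso_def)
  let ?k = "inv_into (carrier S) h"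
  have k: "inj_on ?k (carrier G \<times> carrier B)"
    using bij_betw_inv_into[OF hb] by (simp add: bij_betw_def)
  have Bclosed: "x \<otimes>\<^bsub>B\<^esub> y \<in> carrier B" if "x \<in> carrier B" "y \<in> carrier B" for x y
  proof -
    have "?k (\<one>\<^bsub>G\<^esub>, x) \<in> carrier S" "?k (\<one>\<^bsub>G\<^esub>, y) \<in> carrier S"
      using that bij_betw_inv_into[OF hb] by (auto simp: bij_betw_apply)
    moreover have "h (?k (\<one>\<^bsub>G\<^esub>, x)) = (\<one>\<^bsub>G\<^esub>, x)" "h (?k (\<one>\<^bsub>G\<^esub>, y)) = (\<one>\<^bsub>G\<^esub>, y)"
      using that hb by (auto simp: bij_betw_inv_into_right)
    ultimately have "h (?k (\<one>\<^bsub>G\<^esub>, x) \<otimes>\<^bsub>S\<^esub> ?k (\<one>\<^bsub>G\<^esub>, y)) = (\<one>\<^bsub>G\<^esub>, x \<otimes>\<^bsub>B\<^esub> y)"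
      "?k (\<one>\<^bsub>G\<^esub>, x) \<otimes>\<^bsub>S\<^esub> ?k (\<one>\<^bsub>G\<^esub>, y) \<in> carrier S"
      using hom_mult[OF hh] semigroup_struct.mult_closed[OF S] by simp_all
    then show ?thesis
      using hb by (metis bij_betw_apply mem_Sigma_iff)
  qed
  obtain b0 where b0: "b0 \<in> carrier B"
    using semigroup_struct.carrier_nonempty[OF S] hb by (fastforce simp: bij_betw_def)
  have "inj_on (\<lambda>g. ?k (g, b0)) (carrier G)" "inj_on (\<lambda>b. ?k (\<one>\<^bsub>G\<^esub>, b)) (carrier B)"
    using inj_onD[OF k] b0 by (auto intro!: inj_onI)
  with transport_structure[of _ G] transport_structure[of _ B, OF _ Bclosed]
  obtain G' B' :: "'a monoid" and f g where f: "f \<in> iso G G'" "\<one>\<^bsub>G'\<^esub> = f \<one>\<^bsub>G\<^esub>"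
    and g: "g \<in> iso B B'"
    using G.m_closed by meson
  have "group (G'\<lparr>one := f \<one>\<^bsub>G\<^esub>\<rparr>)"
    using f(1) by (rule G.iso_imp_img_group)
  then have G': "group G'"
    using f(2) by (cases G') simp
  have "nilpotent_group G' n"
    using lower_central_image[OF f(1) G.group_axioms G', of n] G G' f(2)
    by (simp add: nilpotent_group_def)
  moreover have "rectangular_band B'"
  proof -
    obtain L R :: "'b set" where LR: "L \<noteq> {}" "R \<noteq> {}" "B \<cong> band_product L R"
      using B by (auto simp: rectangular_band_def)
    have "B' \<cong> B"
      using inverse_iso[OF g Bclosed] by (auto simp: is_iso_def)
    then show ?thesis
      using LR by (meson iso_trans rectangular_band_if_iso_band_product)
  qed
  moreover have "map_prod f g \<in> iso (G \<times>\<times> B) (G' \<times>\<times> B')"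
    using f(1) g bij_betw_map_prod[of f "carrier G" "carrier G'" g "carrier B" "carrier B'"]
    by (auto simp: iso_def hom_def)
  then have "S \<cong> G' \<times>\<times> B'"
    using iso_set_trans[OF h] by (auto simp: is_iso_def)
  ultimately show ?thesis by blast
qed

end

theory Submission
  imports Defs
begin

text \<open>
Supernilpotence is a statement about cubes: if a polynomial of \<open>n + 1\<close> blocks of variables, each
moving between two values, takes equal values at the two ends of every edge in the last direction
except one, then it does so at that edge as well (\<open>supernilpotent_iff_cube\<close>).

Suppose that \<open>S\<close> is a direct product of an \<open>n\<close>-nilpotent group \<open>G\<close> and a rectangular band. The band
causes no difficulty, since polynomials of left zero and right zero semigroups depend on at most
one variable (\<open>projection_corner\<close>). For the group, one needs that a cube of dimension \<open>n + 1\<close> built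
from variables and constants is determined at its last vertex by the other vertices. To this end,
let level \<open>i\<close> consist of the cubes whose \<open>k\<close>-fold differences lie in the lower central term of weight
\<open>i + k\<close>. As commutators of elements of weights \<open>i\<close> and \<open>j\<close> have weight \<open>i + j\<close>, which rests on the
Hall--Witt identity (\<open>group_commutator_lower_central\<close>), these cubes form a filtered group
(\<open>prolongation\<close>, \<open>cube_level_filtration\<close>). Variables and constants have level 0, hence so do all
polynomial cubes. A cube of dimension \<open>n\<close> and level 1 that is trivial outside its last vertex has a
value of weight \<open>n + 1\<close> there, and the nilpotence of \<open>G\<close> says that such values are trivial
(\<open>cube_corner_unique\<close>).

Conversely, let \<open>S\<close> be orthodox and \<open>n\<close>-supernilpotent. For idempotents \<open>e\<close> and \<open>f\<close>, the words
\<open>e x\<^sub>0 e x\<^sub>1 e \<dots> e\<close> take the value \<open>e f e\<close> when a variable is \<open>f\<close>, and supernilpotence carries this over to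
the vertex at which all variables are \<open>e\<close>; hence \<open>e f e = e\<close> (\<open>idempotent_sandwich\<close>). With this
identity, regularity makes \<open>e S e\<close> a group, and every element of \<open>S\<close> is uniquely a product \<open>l g r\<close> with \<open>g\<close> in \<open>e S e\<close> and
idempotents \<open>l\<close> in \<open>S e\<close> and \<open>r\<close> in \<open>e S\<close>. This is the desired decomposition
(\<open>iso_local_group_times_band\<close>). The group \<open>e S e\<close> is \<open>n\<close>-nilpotent because an iterated commutator of
\<open>n + 1\<close> entries is trivial at all vertices of a cube at which some entry is trivial, and is
therefore trivial at the remaining vertex (\<open>nilpotent_if_embedded_in_supernilpotent\<close>).
\<close>

section \<open>Commutators and the lower central series\<close>

(* Kept folded: nested generating sets send the simplifier astray on membership goals. *)
declare lower_central.simps(2) [simp del]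

context group
begin

definition group_commutator :: "'a \<Rightarrow> 'a \<Rightarrow> 'a" where
  "group_commutator x y = x \<otimes> y \<otimes> inv x \<otimes> inv y"

lemma cancel_inv_left:
  assumes "x \<in> carrier G" "y \<in> carrier G"
  shows "x \<otimes> (inv x \<otimes> y) = y" "inv x \<otimes> (x \<otimes> y) = y"
  using assms by (simp_all flip: m_assoc)

lemmas group_word_simps = group_commutator_def m_assoc inv_mult_group cancel_inv_left

lemma group_commutator_closed [simp]:
  "\<lbrakk>x \<in> carrier G; y \<in> carrier G\<rbrakk> \<Longrightarrow> group_commutator x y \<in> carrier G"
  by (simp add: group_commutator_def)

lemma group_commutator_mult_right:
  assumes "x \<in> carrier G" "y \<in> carrier G" "z \<in> carrier G"
  shows "group_commutator x (y \<otimes> z)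
    = group_commutator x y \<otimes> (y \<otimes> group_commutator x z \<otimes> inv y)"
  using assms by (simp add: group_word_simps)

lemma group_commutator_mult_left:
  assumes "x \<in> carrier G" "y \<in> carrier G" "z \<in> carrier G"
  shows "group_commutator (x \<otimes> y) z
    = (x \<otimes> group_commutator y z \<otimes> inv x) \<otimes> group_commutator x z"
  using assms by (simp add: group_word_simps)

lemma group_commutator_inv_right:
  assumes "x \<in> carrier G" "y \<in> carrier G"
  shows "group_commutator x (inv y) = inv y \<otimes> inv (group_commutator x y) \<otimes> y"
  using assms by (simp add: group_word_simps)

lemma inv_group_commutator:
  assumes "x \<in> carrier G" "y \<in> carrier G"
  shows "inv (group_commutator x y) = group_commutator y x"
  using assms by (simp add: group_word_simps)

lemma group_commutator_swap:
  assumes "subgroup N G" "x \<in> carrier G" "y \<in> carrier G" "group_commutator x y \<in> N"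
  shows "group_commutator y x \<in> N"
  using subgroup.m_inv_closed[OF assms(1,4)] inv_group_commutator[OF assms(2,3)] by simp

lemma conj_eq_group_commutator_mult:
  assumes "x \<in> carrier G" "y \<in> carrier G"
  shows "x \<otimes> y \<otimes> inv x = group_commutator x y \<otimes> y"
  using assms by (simp add: group_word_simps)

text \<open>
The Hall--Witt identity, solved for one of its three factors. It gives
access to commutators one of whose entries is itself a commutator.
\<close>
lemma hall_witt:
  assumes "x \<in> carrier G" "y \<in> carrier G" "z \<in> carrier G"
  shows "group_commutator (group_commutator x y) (y \<otimes> z \<otimes> inv y)
      = inv (group_commutator (group_commutator y z) (z \<otimes> x \<otimes> inv z)
           \<otimes> group_commutator (group_commutator z x) (x \<otimes> y \<otimes> inv x))"
  using assms by (simp add: group_word_simps)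

lemma lower_central_normal: "lower_central G k \<lhd> G"
proof (induction k)
  case 0
  then show ?case
    by (simp add: normal_inv_iff subgroup_self)
next
  case (Suc k)
  let ?X = "{x \<otimes> y \<otimes> inv x \<otimes> inv y | x y. x \<in> carrier G \<and> y \<in> lower_central G k}"
  note lc = lower_central_in_carrier[OF group_axioms, of k]
  show ?case
    unfolding lower_central.simps
  proof (rule normal_generateI)
    show "?X \<subseteq> carrier G" using lc by auto
  next
    fix h g assume h: "h \<in> ?X" and g: "g \<in> carrier G"
    then obtain x y where xy: "x \<in> carrier G" "y \<in> lower_central G k"
      "h = x \<otimes> y \<otimes> inv x \<otimes> inv y" by blast
    then have y: "y \<in> carrier G" using lc by blast
    have "g \<otimes> h \<otimes> inv g = (g \<otimes> x \<otimes> inv g) \<otimes> (g \<otimes> y \<otimes> inv g)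
        \<otimes> inv (g \<otimes> x \<otimes> inv g) \<otimes> inv (g \<otimes> y \<otimes> inv g)"
      using g xy y by (simp add: group_word_simps)
    moreover have "g \<otimes> y \<otimes> inv g \<in> lower_central G k"
      using normal_invE(2)[OF Suc g xy(2)] .
    ultimately show "g \<otimes> h \<otimes> inv g \<in> ?X"
      using g xy(1) by blast
  qed
qed

lemma lower_central_subgroup: "subgroup (lower_central G k) G"
  using lower_central_normal by (rule normal_imp_subgroup)

lemma lower_central_Suc_subset: "lower_central G (Suc k) \<subseteq> lower_central G k"
proof -
  interpret N: normal "lower_central G k" G by (rule lower_central_normal)
  show ?thesis
    unfolding lower_central.simps
  proof (rule generate_subgroup_incl[OF _ N.subgroup_axioms], clarify)
    fix x y assume "x \<in> carrier G" "y \<in> lower_central G k"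
    then show "x \<otimes> y \<otimes> inv x \<otimes> inv y \<in> lower_central G k"
      by (simp add: N.inv_op_closed2)
  qed
qed

lemma group_commutator_lower_central_Suc:
  assumes "x \<in> carrier G" "y \<in> lower_central G k"
  shows "group_commutator x y \<in> lower_central G (Suc k)"
  using assms by (auto simp: group_commutator_def lower_central.simps(2) intro!: generate.incl)

text \<open>
The definition of the lower central series only controls commutators with an arbitrary element on
one side. The term with index \<open>j + 1\<close> is generated by commutators \<open>[z, w]\<close> with \<open>z\<close> arbitrary and
\<open>w\<close> in the term with index \<open>j\<close>. Up to inverses and conjugation, the Hall--Witt identity trades
\<open>[x, [z, w]]\<close> for \<open>[[x, z], w]\<close> and \<open>[[x, w], z]\<close>. The induction hypothesis applies to the commutators
with \<open>w\<close>, and commutators with \<open>z\<close> move one step down by definition. Generators suffice because the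
elements \<open>y\<close> with \<open>[x, y]\<close> in a given normal subgroup form a subgroup.
\<close>
lemma group_commutator_lower_central:
  assumes "x \<in> lower_central G i" "y \<in> lower_central G j"
  shows "group_commutator x y \<in> lower_central G (Suc (i + j))"
  using assms
proof (induction j arbitrary: i x y)
  case 0
  have x: "x \<in> carrier G" and y: "y \<in> carrier G"
    using 0 lower_central_in_carrier[OF group_axioms, of i] by auto
  then show ?case
    using group_commutator_swap[OF lower_central_subgroup y x]
      group_commutator_lower_central_Suc[OF y 0(1)] by simp
next
  case (Suc j)
  let ?N = "lower_central G (Suc (i + Suc j))"
  note N = normal.inv_op_closed1[OF lower_central_normal, of _ _ "Suc (i + Suc j)"]
    normal.inv_op_closed2[OF lower_central_normal, of _ _ "Suc (i + Suc j)"]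
    subgroup.m_closed[OF lower_central_subgroup, of _ "Suc (i + Suc j)"]
    subgroup.m_inv_closed[OF lower_central_subgroup, of _ "Suc (i + Suc j)"]
    subgroup.one_closed[OF lower_central_subgroup, of "Suc (i + Suc j)"]
  note carr = subsetD[OF lower_central_in_carrier[OF group_axioms]]
  note swap = group_commutator_swap[OF lower_central_subgroup]
  have x: "x \<in> carrier G" by (rule carr[OF Suc.prems(1)])
  have basic: "group_commutator x (group_commutator z w) \<in> ?N"
    if z: "z \<in> carrier G" and w: "w \<in> lower_central G j" for z w
  proof -
    have w': "w \<in> carrier G" by (rule carr[OF w])
    \<comment> \<open>The conjugate is chosen such that the third factor of the identity is \<open>[[z, w], x]\<close>.\<close>
    define t where "t = inv w \<otimes> x \<otimes> w"
    have t: "t \<in> lower_central G i"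
      unfolding t_def by (rule normal.inv_op_closed1[OF lower_central_normal w' Suc.prems(1)])
    have t': "t \<in> carrier G" by (rule carr[OF t])
    have x_eq: "w \<otimes> t \<otimes> inv w = x"
      using w' x by (simp add: t_def group_word_simps)
    have "group_commutator w t \<in> lower_central G (Suc (i + j))"
      by (rule swap[OF t' w' Suc.IH[OF t w]])
    then have "group_commutator (t \<otimes> z \<otimes> inv t) (group_commutator w t) \<in> ?N"
      using group_commutator_lower_central_Suc[of "t \<otimes> z \<otimes> inv t"] t' z by simp
    then have 1: "group_commutator (group_commutator w t) (t \<otimes> z \<otimes> inv t) \<in> ?N"
      by (intro swap[of "t \<otimes> z \<otimes> inv t"]) (use t' w' z in simp_all)
    have 2: "group_commutator (group_commutator t z) (z \<otimes> w \<otimes> inv z) \<in> ?N"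
      using Suc.IH[OF swap[OF z t' group_commutator_lower_central_Suc[OF z t]]
          normal.inv_op_closed2[OF lower_central_normal z w]] by simp
    have "group_commutator (group_commutator z w) x \<in> ?N"
      using N(4)[OF N(3)[OF 1 2]] hall_witt[OF z w' t'] unfolding x_eq by simp
    then show ?thesis
      by (intro swap[of "group_commutator z w"]) (use x z w' in simp_all)
  qed
  have "y \<in> generate G {x \<otimes> y \<otimes> inv x \<otimes> inv y | x y. x \<in> carrier G \<and> y \<in> lower_central G j}"
    using Suc.prems(2) by (simp add: lower_central.simps(2))
  then have "y \<in> carrier G \<and> group_commutator x y \<in> ?N"
  proof induction
    case one
    then show ?case
      using x N(5) by (simp add: group_commutator_def)
  next
    case (incl h)
    then obtain z w where zw: "z \<in> carrier G" "w \<in> lower_central G j" "h = group_commutator z w"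
      by (auto simp: group_commutator_def)
    then show ?case
      using basic[OF zw(1,2)] carr[OF zw(2)] by simp
  next
    case (inv h)
    then obtain z w where zw: "z \<in> carrier G" "w \<in> lower_central G j" "h = group_commutator z w"
      by (auto simp: group_commutator_def)
    then have h: "h \<in> carrier G" using carr[OF zw(2)] by simp
    have "inv h \<otimes> inv (group_commutator x h) \<otimes> h \<in> ?N"
      using N(1)[OF h N(4)[OF basic[OF zw(1,2)]]] zw(3) by simp
    then show ?case
      using h group_commutator_inv_right[OF x h] by simp
  next
    case (eng h1 h2)
    then show ?case
      using x N(2,3) by (simp add: group_commutator_mult_right)
  qed
  then show ?case by (rule conjunct2)
qed

end

section \<open>Filtrations of groups\<close>

text \<open>
The top level \<open>\<Gamma> 0\<close> may be a proper subgroup of the carrier: the filtrations obtained by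
prolongation below consist of subgroups that shrink with every step, inside one fixed group.
\<close>
locale group_filtration = group H for H (structure) +
  fixes \<Gamma> :: "nat \<Rightarrow> 'a set"
  assumes subgroup_level: "subgroup (\<Gamma> i) H"
    and level_Suc_subset: "\<Gamma> (Suc i) \<subseteq> \<Gamma> i"
    and commutator_level:
      "\<lbrakk>x \<in> \<Gamma> i; y \<in> \<Gamma> j\<rbrakk> \<Longrightarrow> group_commutator x y \<in> \<Gamma> (i + j)"
begin

lemma level_mono: "i \<le> j \<Longrightarrow> \<Gamma> j \<subseteq> \<Gamma> i"
  by (rule lift_Suc_antimono_le[of \<Gamma>, OF level_Suc_subset])

lemmas level_carrier = subgroup.mem_carrier[OF subgroup_level]
  and level_mult = subgroup.m_closed[OF subgroup_level]
  and level_inv = subgroup.m_inv_closed[OF subgroup_level]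
  and level_one = subgroup.one_closed[OF subgroup_level]

lemma level_conj:
  assumes "x \<in> \<Gamma> i" "y \<in> \<Gamma> j"
  shows "x \<otimes> y \<otimes> inv x \<in> \<Gamma> j" "inv x \<otimes> y \<otimes> x \<in> \<Gamma> j"
proof -
  have *: "z \<otimes> y \<otimes> inv z \<in> \<Gamma> j" if z: "z \<in> \<Gamma> i" for z
  proof -
    have "group_commutator z y \<in> \<Gamma> j"
      using commutator_level[OF z assms(2)] level_mono[of j "i + j"] by auto
    then have "group_commutator z y \<otimes> y \<in> \<Gamma> j"
      by (rule level_mult) (rule assms(2))
    then show ?thesis
      by (simp add: conj_eq_group_commutator_mult level_carrier[OF z] level_carrier[OF assms(2)])
  qed
  show "x \<otimes> y \<otimes> inv x \<in> \<Gamma> j" by (rule *[OF assms(1)])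
  show "inv x \<otimes> y \<otimes> x \<in> \<Gamma> j"
    using *[OF level_inv[OF assms(1)]] level_carrier[OF assms(1)] by simp
qed

text \<open>
If \<open>a\<close> and \<open>s a\<close> agree modulo the next level for an endomorphism \<open>s\<close>, then so do products,
inverses and commutators of such elements, with levels adding up in the last case: writing
\<open>s a = a u\<close> and \<open>s c = c v\<close>, the commutator \<open>[a u, c v]\<close> differs from \<open>[a, c]\<close> by conjugates of
\<open>[u, c v]\<close> and \<open>[a, v]\<close>, each of which is one level deeper. Hence the condition cuts out a
filtration again, and the construction can be iterated.
\<close>
lemma prolongation:
  assumes s: "s \<in> hom H H"
  shows "group_filtration H (\<lambda>i. {a \<in> \<Gamma> i. inv a \<otimes> s a \<in> \<Gamma> (Suc i)})"
proof -
  interpret s: group_hom H H s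
    using s by unfold_locales
  show ?thesis
  proof (intro group_filtration.intro group_filtration_axioms.intro group_axioms)
    fix i
    show "subgroup {a \<in> \<Gamma> i. inv a \<otimes> s a \<in> \<Gamma> (Suc i)} H"
    proof (rule subgroupI)
      show "{a \<in> \<Gamma> i. inv a \<otimes> s a \<in> \<Gamma> (Suc i)} \<subseteq> carrier H"
        by (auto intro: level_carrier)
      have "\<one> \<in> {a \<in> \<Gamma> i. inv a \<otimes> s a \<in> \<Gamma> (Suc i)}"
        using level_one by simp
      then show "{a \<in> \<Gamma> i. inv a \<otimes> s a \<in> \<Gamma> (Suc i)} \<noteq> {}"
        by blast
    next
      fix a assume "a \<in> {a \<in> \<Gamma> i. inv a \<otimes> s a \<in> \<Gamma> (Suc i)}"
      then have a: "a \<in> \<Gamma> i" "inv a \<otimes> s a \<in> \<Gamma> (Suc i)" by auto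
      have "inv (inv a) \<otimes> s (inv a) = a \<otimes> inv (inv a \<otimes> s a) \<otimes> inv a"
        using level_carrier[OF a(1)] by (simp add: group_word_simps)
      then show "inv a \<in> {a \<in> \<Gamma> i. inv a \<otimes> s a \<in> \<Gamma> (Suc i)}"
        using level_inv[OF a(1)] level_conj(1)[OF a(1) level_inv[OF a(2)]] by simp
    next
      fix a c assume "a \<in> {a \<in> \<Gamma> i. inv a \<otimes> s a \<in> \<Gamma> (Suc i)}"
        "c \<in> {a \<in> \<Gamma> i. inv a \<otimes> s a \<in> \<Gamma> (Suc i)}"
      then have a: "a \<in> \<Gamma> i" "inv a \<otimes> s a \<in> \<Gamma> (Suc i)"
        and c: "c \<in> \<Gamma> i" "inv c \<otimes> s c \<in> \<Gamma> (Suc i)" by auto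
      have "inv (a \<otimes> c) \<otimes> s (a \<otimes> c) = (inv c \<otimes> (inv a \<otimes> s a) \<otimes> c) \<otimes> (inv c \<otimes> s c)"
        using level_carrier[OF a(1)] level_carrier[OF c(1)] by (simp add: group_word_simps)
      then show "a \<otimes> c \<in> {a \<in> \<Gamma> i. inv a \<otimes> s a \<in> \<Gamma> (Suc i)}"
        using level_mult[OF level_conj(2)[OF c(1) a(2)] c(2)] level_mult[OF a(1) c(1)] by simp
    qed
    show "{a \<in> \<Gamma> (Suc i). inv a \<otimes> s a \<in> \<Gamma> (Suc (Suc i))}
        \<subseteq> {a \<in> \<Gamma> i. inv a \<otimes> s a \<in> \<Gamma> (Suc i)}"
      using subsetD[OF level_Suc_subset] by auto
  next
    fix a i c j
    assume a: "a \<in> {a \<in> \<Gamma> i. inv a \<otimes> s a \<in> \<Gamma> (Suc i)}"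
      and c: "c \<in> {a \<in> \<Gamma> j. inv a \<otimes> s a \<in> \<Gamma> (Suc j)}"
    define u v where "u = inv a \<otimes> s a" and "v = inv c \<otimes> s c"
    have mem: "a \<in> \<Gamma> i" "c \<in> \<Gamma> j" "u \<in> \<Gamma> (Suc i)" "v \<in> \<Gamma> (Suc j)"
      using a c by (auto simp: u_def v_def)
    note carr [simp] = mem[THEN level_carrier]
    have sa: "s a = a \<otimes> u" and sc: "s c = c \<otimes> v"
      by (simp_all add: u_def v_def group_word_simps)
    have k: "group_commutator a c \<in> \<Gamma> (i + j)"
      by (rule commutator_level[OF mem(1,2)])
    have cv: "c \<otimes> v \<in> \<Gamma> j"
      by (rule level_mult[OF mem(2) subsetD[OF level_Suc_subset mem(4)]])
    have 1: "a \<otimes> group_commutator u (c \<otimes> v) \<otimes> inv a \<in> \<Gamma> (Suc (i + j))"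
      using commutator_level[OF mem(3) cv] level_conj(1)[OF mem(1)] by simp
    have 2: "c \<otimes> group_commutator a v \<otimes> inv c \<in> \<Gamma> (Suc (i + j))"
      using commutator_level[OF mem(1) mem(4)] level_conj(1)[OF mem(2)] by simp
    have "s (group_commutator a c) = group_commutator (a \<otimes> u) (c \<otimes> v)"
      by (simp add: group_commutator_def sa sc)
    also have "\<dots> = (a \<otimes> group_commutator u (c \<otimes> v) \<otimes> inv a)
        \<otimes> (group_commutator a c \<otimes> (c \<otimes> group_commutator a v \<otimes> inv c))"
      by (simp add: group_commutator_mult_left[of a u "c \<otimes> v"] group_commutator_mult_right[of a c v])
    finally have "inv (group_commutator a c) \<otimes> s (group_commutator a c)
      = (inv (group_commutator a c) \<otimes> (a \<otimes> group_commutator u (c \<otimes> v) \<otimes> inv a)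
          \<otimes> group_commutator a c) \<otimes> (c \<otimes> group_commutator a v \<otimes> inv c)"
      by (simp add: m_assoc)
    also have "\<dots> \<in> \<Gamma> (Suc (i + j))"
      using level_mult[OF level_conj(2)[OF k 1] 2] .
    finally show "group_commutator a c
        \<in> {a \<in> \<Gamma> (i + j). inv a \<otimes> s a \<in> \<Gamma> (Suc (i + j))}"
      using k by simp
  qed
qed

end

section \<open>Cubes in a nilpotent group\<close>

text \<open>
A cube of dimension \<open>m\<close> in a group is given by its vertices, which are indexed by the subsets \<open>J\<close>
of \<open>{..<m}\<close>. The functions here live on all sets of numbers, so that cubes of every dimension
belong to one and the same group.
\<close>
definition function_group :: "('a, 'm) monoid_scheme \<Rightarrow> ('i \<Rightarrow> 'a) monoid" where
  "function_group G = \<lparr>carrier = {F. \<forall>J. F J \<in> carrier G},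
     mult = (\<lambda>F E J. F J \<otimes>\<^bsub>G\<^esub> E J), one = (\<lambda>J. \<one>\<^bsub>G\<^esub>)\<rparr>"

lemma function_group_simps [simp]:
  "F \<in> carrier (function_group G) \<longleftrightarrow> (\<forall>J. F J \<in> carrier G)"
  "(F \<otimes>\<^bsub>function_group G\<^esub> E) J = F J \<otimes>\<^bsub>G\<^esub> E J"
  "\<one>\<^bsub>function_group G\<^esub> J = \<one>\<^bsub>G\<^esub>"
  by (simp_all add: function_group_def)

definition shift :: "nat \<Rightarrow> (nat set \<Rightarrow> 'a) \<Rightarrow> nat set \<Rightarrow> 'a" where
  "shift m F J = F (insert m J)"

definition difference :: "('a, 'm) monoid_scheme \<Rightarrow> nat \<Rightarrow> (nat set \<Rightarrow> 'a) \<Rightarrow> nat set \<Rightarrow> 'a" where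
  "difference G m F J = inv\<^bsub>G\<^esub> (F J) \<otimes>\<^bsub>G\<^esub> F (insert m J)"

text \<open>
Level \<open>i\<close> consists of the cubes all of whose \<open>k\<close>-fold differences in distinct directions below \<open>m\<close>,
taken in decreasing order, have values in the lower central term of weight \<open>i + k\<close>. These are the Host--Kra cubes of the lower
central filtration. The weight is shifted against the index of \<open>lower_central\<close>, where the whole
group has index 0 but has to count both as weight 0 and as weight 1; truncated subtraction does
exactly this.
\<close>
primrec cube_level :: "('a, 'm) monoid_scheme \<Rightarrow> nat \<Rightarrow> nat \<Rightarrow> (nat set \<Rightarrow> 'a) set" where
  "cube_level G 0 i = {F. \<forall>J. F J \<in> lower_central G (i - 1)}"
| "cube_level G (Suc m) i = {F \<in> cube_level G m i. difference G m F \<in> cube_level G m (Suc i)}"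

context group
begin

lemma function_group_group: "group (function_group G :: ('i \<Rightarrow> 'a) monoid)"
proof (rule groupI)
  fix F :: "'i \<Rightarrow> 'a" assume "F \<in> carrier (function_group G)"
  then show "\<exists>E\<in>carrier (function_group G). E \<otimes>\<^bsub>function_group G\<^esub> F = \<one>\<^bsub>function_group G\<^esub>"
    by (intro bexI[of _ "\<lambda>J. inv (F J)"]) auto
qed (auto simp: m_assoc)

lemma function_group_inv:
  assumes "F \<in> carrier (function_group G)"
  shows "(inv\<^bsub>function_group G\<^esub> F) J = inv (F J)"
proof -
  have "inv\<^bsub>function_group G\<^esub> F = (\<lambda>J. inv (F J))"
    by (rule group.inv_equality[OF function_group_group]) (use assms in auto)
  then show ?thesis by simp
qed

lemma lower_central_antimono: "i \<le> j \<Longrightarrow> lower_central G j \<subseteq> lower_central G i"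
  by (rule lift_Suc_antimono_le[of "lower_central G", OF lower_central_Suc_subset])

text \<open>
Passing from dimension \<open>m\<close> to \<open>m + 1\<close> is a prolongation along the shift in direction \<open>m\<close>. That the
cubes of a level form a group is what makes the levels useful: a product of variables and
constants is a cube of level 0 as soon as its factors are.
\<close>
lemma cube_level_filtration: "group_filtration (function_group G) (cube_level G m)"
proof (induction m)
  case 0
  interpret FG: group "function_group G :: (nat set \<Rightarrow> 'a) monoid"
    by (rule function_group_group)
  have carr: "F \<in> carrier (function_group G)" if "F \<in> cube_level G 0 i" for F i
    using that lower_central_in_carrier[OF group_axioms, of "i - 1"] by auto
  have comm: "group_commutator x y \<in> lower_central G (i + j - 1)"
    if "x \<in> lower_central G (i - 1)" "y \<in> lower_central G (j - 1)" for x y i j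
  proof (rule subsetD[OF lower_central_antimono group_commutator_lower_central[OF that]])
    show "i + j - 1 \<le> Suc (i - 1 + (j - 1))" by arith
  qed
  show ?case
  proof (intro group_filtration.intro group_filtration_axioms.intro FG.group_axioms)
    fix i
    show "subgroup (cube_level G 0 i) (function_group G)"
    proof (rule FG.subgroupI)
      show "cube_level G 0 i \<subseteq> carrier (function_group G)"
        using carr by blast
      have "(\<lambda>J. \<one>) \<in> cube_level G 0 i"
        using subgroup.one_closed[OF lower_central_subgroup] by simp
      then show "cube_level G 0 i \<noteq> {}" by blast
    next
      fix F assume F: "F \<in> cube_level G 0 i"
      then have "F \<in> carrier (function_group G)"
        by (rule carr)
      then show "inv\<^bsub>function_group G\<^esub> F \<in> cube_level G 0 i"
        using F subgroup.m_inv_closed[OF lower_central_subgroup] by (simp add: function_group_inv)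
    next
      fix F E assume "F \<in> cube_level G 0 i" "E \<in> cube_level G 0 i"
      then show "F \<otimes>\<^bsub>function_group G\<^esub> E \<in> cube_level G 0 i"
        using subgroup.m_closed[OF lower_central_subgroup] by simp
    qed
    show "cube_level G 0 (Suc i) \<subseteq> cube_level G 0 i"
      using subsetD[OF lower_central_antimono[of "i - 1" i]] by auto
  next
    fix F E i j assume FE: "F \<in> cube_level G 0 i" "E \<in> cube_level G 0 j"
    then have "F \<in> carrier (function_group G)" "E \<in> carrier (function_group G)"
      by (auto intro: carr simp del: cube_level.simps function_group_simps)
    then have "FG.group_commutator F E J = group_commutator (F J) (E J)" for J
      by (simp add: FG.group_commutator_def group_commutator_def function_group_inv)
    then show "FG.group_commutator F E \<in> cube_level G 0 (i + j)"
      using comm FE by simp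
  qed
next
  case (Suc m)
  interpret P: group_filtration "function_group G :: (nat set \<Rightarrow> 'a) monoid" "cube_level G m"
    by (rule Suc)
  have "cube_level G (Suc m) i = {F \<in> cube_level G m i.
      inv\<^bsub>function_group G\<^esub> F \<otimes>\<^bsub>function_group G\<^esub> shift m F \<in> cube_level G m (Suc i)}"
    for i
  proof -
    have "difference G m F = inv\<^bsub>function_group G\<^esub> F \<otimes>\<^bsub>function_group G\<^esub> shift m F"
      if "F \<in> cube_level G m i" for F
      using P.level_carrier[OF that]
      by (simp add: fun_eq_iff difference_def shift_def function_group_inv)
    then show ?thesis by (simp cong: conj_cong)
  qed
  then have eq: "cube_level G (Suc m) = (\<lambda>i. {F \<in> cube_level G m i.
      inv\<^bsub>function_group G\<^esub> F \<otimes>\<^bsub>function_group G\<^esub> shift m F \<in> cube_level G m (Suc i)})"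
    by (rule ext)
  have "shift m \<in> hom (function_group G) (function_group G)"
    by (auto simp: hom_def shift_def fun_eq_iff)
  then show ?case
    unfolding eq by (rule P.prolongation)
qed

lemma cube_level_independent:
  assumes "\<And>J. F J \<in> lower_central G (i - 1)" and "\<And>k J. k < m \<Longrightarrow> F (insert k J) = F J"
  shows "F \<in> cube_level G m i"
  using assms
proof (induction m arbitrary: F i)
  case 0
  then show ?case by simp
next
  case (Suc m)
  have "F J \<in> carrier G" for J
    using Suc.prems(1) lower_central_in_carrier[OF group_axioms] by blast
  then have "difference G m F = (\<lambda>J. \<one>)"
    using Suc.prems(2)[of m] by (simp add: fun_eq_iff difference_def)
  moreover have "(\<lambda>J. \<one>) \<in> cube_level G m (Suc i)"
    by (rule Suc.IH) (simp_all add: subgroup.one_closed[OF lower_central_subgroup])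
  ultimately show ?case
    using Suc by simp
qed

text \<open>
A variable that moves between two values along direction \<open>j\<close> has only one nontrivial difference.
For \<open>m = j\<close> this difference is constant in all directions below \<open>m\<close>, and its values lie in the
whole group, which has weight 1.
\<close>
lemma cube_level_coordinate:
  assumes "u \<in> carrier G" "w \<in> carrier G"
  shows "(\<lambda>J. if j \<in> J then w else u) \<in> cube_level G m 0"
proof (induction m)
  case 0
  then show ?case using assms by simp
next
  case (Suc m)
  have "difference G m (\<lambda>J. if j \<in> J then w else u) \<in> cube_level G m (Suc 0)"
    using assms by (intro cube_level_independent) (auto simp: difference_def)
  then show ?case using Suc by simp
qed

text \<open>
If every vertex but the last is trivial, then taking the difference in the last direction keeps
this property and the value at the last vertex, while it lowers the dimension and raises the
level by one.
\<close>
lemma cube_level_top: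
  assumes "F \<in> cube_level G m i" and "\<And>J. J \<subset> {..<m} \<Longrightarrow> F J = \<one>"
  shows "F {..<m} \<in> lower_central G (i + m - 1)"
  using assms
proof (induction m arbitrary: i F)
  case 0
  then show ?case by simp
next
  case (Suc m)
  interpret P: group_filtration "function_group G :: (nat set \<Rightarrow> 'a) monoid" "cube_level G m"
    by (rule cube_level_filtration)
  have F: "F \<in> carrier (function_group G)"
    using Suc.prems(1) P.level_carrier by auto
  have ins: "insert m J \<subset> {..<Suc m}" if "J \<subset> {..<m}" for J
    using that by (auto simp: lessThan_Suc)
  have "difference G m F {..<m} \<in> lower_central G (Suc i + m - 1)"
  proof (rule Suc.IH)
    show "difference G m F \<in> cube_level G m (Suc i)"
      using Suc.prems(1) by simp
    show "difference G m F J = \<one>" if "J \<subset> {..<m}" for J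
    proof -
      have "J \<subset> {..<Suc m}" using that by (auto simp: lessThan_Suc)
      then show ?thesis
        using Suc.prems(2) ins[OF that] by (simp add: difference_def)
    qed
  qed
  moreover have "difference G m F {..<m} = F {..<Suc m}"
    using Suc.prems(2)[of "{..<m}"] F by (auto simp: difference_def lessThan_Suc)
  ultimately show ?case by simp
qed

text \<open>
Two opposite faces that agree outside one vertex have a difference of level 1 that is trivial
outside that vertex, so its value there has weight \<open>n + 1\<close> and vanishes.
\<close>
lemma cube_corner_unique:
  assumes nil: "lower_central G n = {\<one>}" and F: "F \<in> cube_level G (Suc n) 0"
    and eq: "\<And>J. J \<subset> {..<n} \<Longrightarrow> F (insert n J) = F J"
  shows "F {..<Suc n} = F {..<n}"
proof -
  interpret P: group_filtration "function_group G :: (nat set \<Rightarrow> 'a) monoid" "cube_level G n"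
    by (rule cube_level_filtration)
  have carr: "F \<in> carrier (function_group G)"
    using F P.level_carrier by auto
  have "difference G n F {..<n} \<in> lower_central G (1 + n - 1)"
  proof (rule cube_level_top)
    show "difference G n F \<in> cube_level G n 1" using F by simp
    show "difference G n F J = \<one>" if "J \<subset> {..<n}" for J
      using eq[OF that] carr by (simp add: difference_def)
  qed
  then have "inv (F {..<n}) \<otimes> F {..<Suc n} = \<one>"
    using nil by (simp add: difference_def lessThan_Suc)
  then show ?thesis
    using carr by (simp add: inv_solve_left' flip: inv_solve_left)
qed

end

section \<open>Supernilpotence on cubes of tuples\<close>

text \<open>
The tuple at the vertex \<open>J\<close> of the cube spanned by the blocks \<open>u j\<close> and \<open>w j\<close>. Unlike in
\<open>choose_tuples\<close>, the pair \<open>c\<close>, \<open>d\<close> is just the last of the \<open>m\<close> blocks, which restores the symmetry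
between all arguments of the commutator.
\<close>
definition cube_point :: "(nat \<Rightarrow> 'a list) \<Rightarrow> (nat \<Rightarrow> 'a list) \<Rightarrow> nat \<Rightarrow> nat set \<Rightarrow> 'a list" where
  "cube_point u w m J = concat (map (\<lambda>j. if j \<in> J then w j else u j) [0..<m])"

lemma cube_point_Suc:
  "cube_point u w (Suc m) J = cube_point u w m J @ (if m \<in> J then w m else u m)"
  by (simp add: cube_point_def)

lemma cube_point_cong:
  assumes "\<And>j. j < m \<Longrightarrow> j \<in> J \<longleftrightarrow> j \<in> J'"
    "\<And>j. j < m \<Longrightarrow> u j = u' j" "\<And>j. j < m \<Longrightarrow> w j = w' j"
  shows "cube_point u w m J = cube_point u' w' m J'"
  unfolding cube_point_def by (intro arg_cong[where f = concat] map_cong) (use assms in auto)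

definition tuple_cube :: "'a set \<Rightarrow> (nat \<Rightarrow> 'a list) \<Rightarrow> (nat \<Rightarrow> 'a list) \<Rightarrow> nat \<Rightarrow> bool" where
  "tuple_cube A u w m \<longleftrightarrow> (\<forall>j<m. length (w j) = length (u j) \<and> u j \<noteq> [] \<and>
     set (u j) \<subseteq> A \<and> set (w j) \<subseteq> A)"

lemma tuple_cube_Suc:
  "tuple_cube A u w (Suc m) \<longleftrightarrow> tuple_cube A u w m \<and> length (w m) = length (u m) \<and> u m \<noteq> [] \<and>
     set (u m) \<subseteq> A \<and> set (w m) \<subseteq> A"
  by (auto simp: tuple_cube_def less_Suc_eq)

lemma cube_point_tuple:
  assumes "tuple_cube A u w m"
  shows "length (cube_point u w m J) = (\<Sum>j<m. length (u j))" "set (cube_point u w m J) \<subseteq> A"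
  using assms
  by (induction m) (auto simp: cube_point_Suc tuple_cube_Suc, simp_all add: cube_point_def)

lemma zero_cong_congruence:
  assumes "semigroup_struct S"
  shows "zero_cong S \<in> congruences S"
  using semigroup_struct.mult_closed[OF assms]
  by (auto simp: congruences_def zero_cong_def equiv_def refl_on_def sym_def trans_def)

lemma supernilpotent_iff_centralizes:
  assumes S: "semigroup_struct S"
  shows "supernilpotent S n \<longleftrightarrow>
    centralizes S (replicate n (one_cong S)) (one_cong S) (zero_cong S)"
proof -
  let ?\<alpha> = "replicate (n + 1) (one_cong S)"
  have \<alpha>: "set ?\<alpha> \<subseteq> congruences S" "?\<alpha> \<noteq> []" "butlast ?\<alpha> = replicate n (one_cong S)"
    "last ?\<alpha> = one_cong S"
    using one_cong_congruence[OF S] by (auto simp: butlast_conv_take simp del: replicate.simps)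
  note least = commutator_least[OF S \<alpha>(1,2), unfolded \<alpha>(3,4)]
  have "zero_cong S \<subseteq> commutator S ?\<alpha>"
    using least(1) by (auto simp: congruences_def zero_cong_def equiv_def refl_on_def)
  then show ?thesis
    unfolding supernilpotent_def
    using least(2) least(3)[OF zero_cong_congruence[OF S]] by fastforce
qed

text \<open>
The commutator is the least congruence with the term condition, so it is the equality relation
precisely if that relation satisfies the condition. The latter then compares the values of a
polynomial at the ends of the edges of a cube in direction \<open>n\<close>.
\<close>
lemma supernilpotent_iff_cube:
  assumes S: "semigroup_struct S"
  shows "supernilpotent S n \<longleftrightarrow>
    (\<forall>u w p. tuple_cube (carrier S) u w (Suc n) \<longrightarrow>
       p \<in> polynomials S (\<Sum>j<Suc n. length (u j)) \<longrightarrow>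
       (\<forall>J. J \<subset> {..<n} \<longrightarrow>
          p (cube_point u w (Suc n) (insert n J)) = p (cube_point u w (Suc n) J)) \<longrightarrow>
       p (cube_point u w (Suc n) {..<Suc n}) = p (cube_point u w (Suc n) {..<n}))"
    (is "_ = ?cube")
proof -
  let ?\<alpha> = "replicate n (one_cong S)"
  have "centralizes S ?\<alpha> (one_cong S) (zero_cong S) \<longleftrightarrow> ?cube"
  proof
    assume cent: "centralizes S ?\<alpha> (one_cong S) (zero_cong S)"
    show ?cube
    proof (intro allI impI)
      fix u w p
      assume uw: "tuple_cube (carrier S) u w (Suc n)"
        and p: "p \<in> polynomials S (\<Sum>j<Suc n. length (u j))"
        and eq: "\<forall>J. J \<subset> {..<n} \<longrightarrow>
          p (cube_point u w (Suc n) (insert n J)) = p (cube_point u w (Suc n) J)"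
      let ?as = "map u [0..<n]" and ?bs = "map w [0..<n]"
      have choose: "choose_tuples J ?as ?bs = cube_point u w n J" for J
        by (auto simp: choose_tuples_def cube_point_def intro!: arg_cong[where f = concat])
      have top: "concat ?bs = cube_point u w n {..<n}"
        by (auto simp: cube_point_def intro!: arg_cong[where f = concat])
      have ns: "sum_list (map (\<lambda>j. length (u j)) [0..<n]) + length (u n) = (\<Sum>j<Suc n. length (u j))"
        by (simp add: interv_sum_list_conv_sum_set_nat atLeast0LessThan)
      have ins: "cube_point u w n (insert n J) = cube_point u w n J" for J
        by (rule cube_point_cong) auto
      have ins': "cube_point u w n {..<Suc n} = cube_point u w n {..<n}"
        by (rule cube_point_cong) auto
      have rel: "related_tuples (one_cong S) (u j) (w j)" if "j < Suc n" for j
        using uw that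
        by (auto simp: tuple_cube_def related_tuples_def one_cong_def list_all2_conv_all_nth subset_iff)
      have "(p (concat ?bs @ u n), p (concat ?bs @ w n)) \<in> zero_cong S"
      proof (rule cent[unfolded centralizes_def, rule_format,
            of "map (\<lambda>j. length (u j)) [0..<n]" "length (u n)" p ?as ?bs "u n" "w n"])
        show "p \<in> polynomials S (sum_list (map (\<lambda>j. length (u j)) [0..<n]) + length (u n))"
          using p by (simp only: ns)
        fix J assume "J \<subset> {..<length ?\<alpha>}"
        then have J: "J \<subset> {..<n}" by simp
        have "p (cube_point u w (Suc n) J) \<in> carrier S"
          by (rule polynomials_closed[OF S p]) (use cube_point_tuple[OF uw] in auto)
        moreover have "n \<notin> J" using J by auto
        ultimately show "(p (choose_tuples J ?as ?bs @ u n), p (choose_tuples J ?as ?bs @ w n))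
            \<in> zero_cong S"
          using eq[rule_format, OF J]
          by (simp add: choose cube_point_Suc ins zero_cong_def Id_on_def)
      qed (use uw rel in \<open>auto simp: tuple_cube_def Suc_le_eq\<close>)
      then show "p (cube_point u w (Suc n) {..<Suc n}) = p (cube_point u w (Suc n) {..<n})"
        unfolding top by (auto simp: cube_point_Suc ins' zero_cong_def)
    qed
  next
    assume cube: ?cube
    show "centralizes S ?\<alpha> (one_cong S) (zero_cong S)"
      unfolding centralizes_def
    proof (intro allI impI)
      fix ns m p as bs c d
      assume len: "length ns = length ?\<alpha>" and pos: "\<forall>j<length ?\<alpha>. 1 \<le> ns ! j" "1 \<le> m"
        and p: "p \<in> polynomials S (sum_list ns + m)"
        and lens: "length as = length ?\<alpha>" "length bs = length ?\<alpha>"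
        and ab: "\<forall>j<length ?\<alpha>. length (as ! j) = ns ! j \<and> length (bs ! j) = ns ! j \<and>
           related_tuples (?\<alpha> ! j) (as ! j) (bs ! j)"
        and cd: "length c = m" "length d = m" "related_tuples (one_cong S) c d"
        and eq: "\<forall>J. J \<subset> {..<length ?\<alpha>} \<longrightarrow>
           (p (choose_tuples J as bs @ c), p (choose_tuples J as bs @ d)) \<in> zero_cong S"
      define u where "u = (\<lambda>j. if j < n then as ! j else c)"
      define w where "w = (\<lambda>j. if j < n then bs ! j else d)"
      have rel: "set x \<subseteq> carrier S" "set y \<subseteq> carrier S" if "related_tuples (one_cong S) x y" for x y
        using related_tuples_carrier[OF that, of "carrier S"] by (auto simp: one_cong_def)
      have uw: "tuple_cube (carrier S) u w (Suc n)"
        unfolding tuple_cube_def u_def w_def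
      proof (intro allI impI)
        fix j assume "j < Suc n"
        show "length (if j < n then bs ! j else d) = length (if j < n then as ! j else c) \<and>
          (if j < n then as ! j else c) \<noteq> [] \<and>
          set (if j < n then as ! j else c) \<subseteq> carrier S \<and>
          set (if j < n then bs ! j else d) \<subseteq> carrier S"
        proof (cases "j < n")
          case True
          then have "length (as ! j) = ns ! j" "length (bs ! j) = ns ! j" "1 \<le> ns ! j"
            "related_tuples (one_cong S) (as ! j) (bs ! j)"
            using ab pos(1) by auto
          then show ?thesis
            using True rel by fastforce
        next
          case False
          then show ?thesis using cd pos(2) rel[OF cd(3)] by auto
        qed
      qed
      have "ns = map (\<lambda>j. length (u j)) [0..<n]"
        using len ab by (intro nth_equalityI) (auto simp: u_def)
      then have ns: "sum_list ns + m = (\<Sum>j<Suc n. length (u j))"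
        using cd(1) by (simp add: interv_sum_list_conv_sum_set_nat atLeast0LessThan u_def)
      have p': "p \<in> polynomials S (\<Sum>j<Suc n. length (u j))"
        using p unfolding ns .
      have choose: "choose_tuples J as bs = cube_point u w n J" for J
        using lens unfolding choose_tuples_def cube_point_def
        by (intro arg_cong[where f = concat] map_cong) (auto simp: u_def w_def)
      have "bs = map w [0..<n]"
        using lens by (intro nth_equalityI) (auto simp: w_def)
      then have top: "concat bs = cube_point u w n {..<n}"
        by (auto simp: cube_point_def intro!: arg_cong[where f = concat])
      have ins: "cube_point u w n (insert n J) = cube_point u w n J" for J
        by (rule cube_point_cong) auto
      have ins': "cube_point u w n {..<Suc n} = cube_point u w n {..<n}"
        by (rule cube_point_cong) auto
      have last: "u n = c" "w n = d" by (simp_all add: u_def w_def)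
      have "p (cube_point u w (Suc n) {..<Suc n}) = p (cube_point u w (Suc n) {..<n})"
      proof (rule cube[rule_format, OF uw p'])
        fix J :: "nat set" assume J: "J \<subset> {..<n}"
        then have "n \<notin> J" by auto
        then show "p (cube_point u w (Suc n) (insert n J)) = p (cube_point u w (Suc n) J)"
          using eq[rule_format, of J] J by (auto simp: choose cube_point_Suc ins last zero_cong_def)
      qed
      moreover have "p (cube_point u w (Suc n) {..<n}) \<in> carrier S"
        by (rule polynomials_closed[OF S p']) (use cube_point_tuple[OF uw] in auto)
      ultimately show "(p (concat bs @ c), p (concat bs @ d)) \<in> zero_cong S"
        by (simp add: top cube_point_Suc ins' last zero_cong_def Id_on_def)
    qed
  qed
  then show ?thesis
    by (simp add: supernilpotent_iff_centralizes[OF S])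
qed

section \<open>Nilpotent groups times rectangular bands are supernilpotent\<close>

lemma cube_point_nth:
  assumes "tuple_cube A u w m" "i < (\<Sum>j<m. length (u j))"
  shows "\<exists>j<m. \<exists>q<length (u j). \<forall>J. cube_point u w m J ! i = (if j \<in> J then w j ! q else u j ! q)"
  using assms
proof (induction m)
  case (Suc m)
  note len = cube_point_tuple(1)[of A u w m]
  show ?case
  proof (cases "i < (\<Sum>j<m. length (u j))")
    case True
    then obtain j q where "j < m" "q < length (u j)"
      "\<And>J. cube_point u w m J ! i = (if j \<in> J then w j ! q else u j ! q)"
      using Suc by (auto simp: tuple_cube_Suc)
    then show ?thesis
      using True Suc.prems(1) len
      by (intro exI[of _ j] conjI exI[of _ q]) (auto simp: tuple_cube_Suc cube_point_Suc nth_append)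
  next
    case False
    then show ?thesis
      using Suc.prems len
      by (intro exI[of _ m] conjI exI[of _ "i - (\<Sum>j<m. length (u j))"])
        (auto simp: tuple_cube_Suc cube_point_Suc nth_append)
  qed
qed simp

text \<open>
Induction on the polynomial: variables and constants give cubes of level 0, and these are closed
under multiplication. Inverses do not occur in the polynomial, so a homomorphism of semigroups
into the group is enough.
\<close>
lemma polynomial_cube_level:
  fixes S :: "('a, 'm) monoid_scheme" and G :: "('g, 'k) monoid_scheme"
  assumes S: "semigroup_struct S" and G: "group G" and \<phi>: "\<phi> \<in> hom S G"
    and uw: "tuple_cube (carrier S) u w m" and p: "p \<in> polynomials S (\<Sum>j<m. length (u j))"
  shows "(\<lambda>J. \<phi> (p (cube_point u w m J))) \<in> cube_level G k 0"
proof -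
  interpret G: group G by (rule G)
  interpret P: group_filtration "function_group G :: (nat set \<Rightarrow> 'g) monoid" "cube_level G k"
    by (rule G.cube_level_filtration)
  from p show ?thesis
  proof induction
    case (Var i)
    obtain j q where jq: "j < m" "q < length (u j)"
      "\<And>J. cube_point u w m J ! i = (if j \<in> J then w j ! q else u j ! q)"
      using cube_point_nth[OF uw Var] by blast
    have "u j ! q \<in> carrier S" "w j ! q \<in> carrier S"
      using uw jq by (auto simp: tuple_cube_def subset_iff)
    then have "(\<lambda>J. if j \<in> J then \<phi> (w j ! q) else \<phi> (u j ! q)) \<in> cube_level G k 0"
      using \<phi> by (intro G.cube_level_coordinate) (auto simp: hom_def)
    then show ?case
      unfolding jq(3) by (simp add: if_distrib)
  next
    case (Const a)
    then show ?case
      using \<phi> by (intro G.cube_level_independent) (auto simp: hom_def)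
  next
    case (Mult p q)
    have "\<phi> (p (cube_point u w m J) \<otimes>\<^bsub>S\<^esub> q (cube_point u w m J)) =
        \<phi> (p (cube_point u w m J)) \<otimes>\<^bsub>G\<^esub> \<phi> (q (cube_point u w m J))" for J
      using Mult.hyps polynomials_closed[OF S] cube_point_tuple[OF uw] by (intro hom_mult[OF \<phi>]) auto
    moreover note P.level_mult[OF Mult.IH]
    ultimately show ?case
      by (simp add: function_group_def)
  qed
qed

text \<open>
In a left zero or right zero semigroup a product equals its first or last letter, so a polynomial
depends on at most one of its arguments.
\<close>
lemma polynomial_projection:
  assumes S: "semigroup_struct S"
    and \<pi>: "(\<forall>x\<in>carrier S. \<forall>y\<in>carrier S. \<pi> (x \<otimes>\<^bsub>S\<^esub> y) = \<pi> x) \<or>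
      (\<forall>x\<in>carrier S. \<forall>y\<in>carrier S. \<pi> (x \<otimes>\<^bsub>S\<^esub> y) = \<pi> y)"
    and p: "p \<in> polynomials S N"
  shows "(\<exists>c. \<forall>v. length v = N \<longrightarrow> set v \<subseteq> carrier S \<longrightarrow> \<pi> (p v) = c) \<or>
    (\<exists>i<N. \<forall>v. length v = N \<longrightarrow> set v \<subseteq> carrier S \<longrightarrow> \<pi> (p v) = \<pi> (v ! i))"
  using p
proof induction
  case (Mult p q)
  note closed = polynomials_closed[OF S Mult.hyps(1)] polynomials_closed[OF S Mult.hyps(2)]
  from \<pi> show ?case
  proof
    assume "\<forall>x\<in>carrier S. \<forall>y\<in>carrier S. \<pi> (x \<otimes>\<^bsub>S\<^esub> y) = \<pi> x"
    then have "\<pi> (p v \<otimes>\<^bsub>S\<^esub> q v) = \<pi> (p v)" if "length v = N" "set v \<subseteq> carrier S" for v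
      using closed that by blast
    then show ?thesis using Mult.IH(1) by simp
  next
    assume "\<forall>x\<in>carrier S. \<forall>y\<in>carrier S. \<pi> (x \<otimes>\<^bsub>S\<^esub> y) = \<pi> y"
    then have "\<pi> (p v \<otimes>\<^bsub>S\<^esub> q v) = \<pi> (q v)" if "length v = N" "set v \<subseteq> carrier S" for v
      using closed that by blast
    then show ?thesis using Mult.IH(2) by simp
  qed
qed auto

text \<open>
The single coordinate on which the value depends moves along one direction. If this is the
direction \<open>n\<close> then any edge in that direction, such as the one at the empty set, shows that its
two values have the same image; otherwise the two vertices in question have the same coordinate.
The edge at the empty set is among the hypotheses because \<open>n\<close> is positive.
\<close>
lemma projection_corner:
  assumes S: "semigroup_struct S" and n: "1 \<le> n"
    and proj: "(\<forall>x\<in>carrier S. \<forall>y\<in>carrier S. \<pi> (x \<otimes>\<^bsub>S\<^esub> y) = \<pi> x) \<or>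
      (\<forall>x\<in>carrier S. \<forall>y\<in>carrier S. \<pi> (x \<otimes>\<^bsub>S\<^esub> y) = \<pi> y)"
    and uw: "tuple_cube (carrier S) u w (Suc n)"
    and p: "p \<in> polynomials S (\<Sum>j<Suc n. length (u j))"
    and eq: "\<forall>J. J \<subset> {..<n} \<longrightarrow>
          p (cube_point u w (Suc n) (insert n J)) = p (cube_point u w (Suc n) J)"
  shows "\<pi> (p (cube_point u w (Suc n) {..<Suc n})) = \<pi> (p (cube_point u w (Suc n) {..<n}))"
  using polynomial_projection[OF S proj p]
proof (elim disjE exE conjE)
  fix c assume "\<forall>v. length v = (\<Sum>j<Suc n. length (u j)) \<longrightarrow> set v \<subseteq> carrier S \<longrightarrow> \<pi> (p v) = c"
  then show ?thesis
    using cube_point_tuple[OF uw] by metis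
next
  fix i assume i: "i < (\<Sum>j<Suc n. length (u j))"
    and "\<forall>v. length v = (\<Sum>j<Suc n. length (u j)) \<longrightarrow> set v \<subseteq> carrier S \<longrightarrow> \<pi> (p v) = \<pi> (v ! i)"
  then have \<pi>: "\<pi> (p (cube_point u w (Suc n) J)) = \<pi> (cube_point u w (Suc n) J ! i)" for J
    using cube_point_tuple[OF uw] by metis
  obtain j q where jq: "j < Suc n"
    "\<And>J. cube_point u w (Suc n) J ! i = (if j \<in> J then w j ! q else u j ! q)"
    using cube_point_nth[OF uw i] by blast
  have "0 \<in> {..<n}" using n by simp
  then have "{} \<subset> {..<n}" by blast
  then have "\<pi> (p (cube_point u w (Suc n) {n})) = \<pi> (p (cube_point u w (Suc n) {}))"
    using eq by auto
  then show ?thesis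
    unfolding \<pi> jq(2) using jq(1) by (cases "j = n") auto
qed

text \<open>
The decomposition enters only through its three coordinate maps, into a nilpotent group, a left
zero semigroup and a right zero semigroup. It suffices to compare the two vertices under each.
\<close>
lemma supernilpotent_if_jointly_injective:
  fixes S :: "('a, 'm) monoid_scheme" and G :: "('g, 'k) monoid_scheme"
  assumes S: "semigroup_struct S" and n: "1 \<le> n"
    and G: "nilpotent_group G n" and \<phi>: "\<phi> \<in> hom S G"
    and lp: "\<forall>x\<in>carrier S. \<forall>y\<in>carrier S. lp (x \<otimes>\<^bsub>S\<^esub> y) = lp x"
    and rp: "\<forall>x\<in>carrier S. \<forall>y\<in>carrier S. rp (x \<otimes>\<^bsub>S\<^esub> y) = rp y"
    and inj: "\<And>x y. \<lbrakk>x \<in> carrier S; y \<in> carrier S; \<phi> x = \<phi> y; lp x = lp y; rp x = rp y\<rbrakk> \<Longrightarrow> x = y"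
  shows "supernilpotent S n"
  unfolding supernilpotent_iff_cube[OF S]
proof (intro allI impI)
  fix u w p
  assume uw: "tuple_cube (carrier S) u w (Suc n)"
    and p: "p \<in> polynomials S (\<Sum>j<Suc n. length (u j))"
    and eq: "\<forall>J. J \<subset> {..<n} \<longrightarrow>
          p (cube_point u w (Suc n) (insert n J)) = p (cube_point u w (Suc n) J)"
  interpret G: group G using G by (simp add: nilpotent_group_def)
  let ?P = "\<lambda>J. p (cube_point u w (Suc n) J)"
  have closed: "?P J \<in> carrier S" for J
    by (rule polynomials_closed[OF S p]) (use cube_point_tuple[OF uw] in auto)
  have "\<phi> (?P {..<Suc n}) = \<phi> (?P {..<n})"
  proof (rule G.cube_corner_unique)
    show "lower_central G n = {\<one>\<^bsub>G\<^esub>}" using G by (simp add: nilpotent_group_def)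
    show "(\<lambda>J. \<phi> (?P J)) \<in> cube_level G (Suc n) 0"
      by (rule polynomial_cube_level[OF S G.group_axioms \<phi> uw p])
  qed (use eq in simp)
  then show "?P {..<Suc n} = ?P {..<n}"
    by (rule inj[OF closed closed _ projection_corner[OF S n disjI1[OF lp] uw p eq]
          projection_corner[OF S n disjI2[OF rp] uw p eq]])
qed

lemma supernilpotent_if_iso_group_times_band:
  fixes S :: "('a, 'm) monoid_scheme" and G :: "('g, 'k) monoid_scheme"
    and B :: "('b, 'l) monoid_scheme"
  assumes S: "semigroup_struct S" and n: "1 \<le> n"
    and G: "nilpotent_group G n" and B: "rectangular_band B" and iso: "S \<cong> G \<times>\<times> B"
  shows "supernilpotent S n"
proof -
  obtain h where h: "h \<in> hom S (G \<times>\<times> B)" "inj_on h (carrier S)"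
    using iso by (auto simp: is_iso_def iso_def bij_betw_def)
  obtain L R :: "'b set" and k where k: "k \<in> hom B (band_product L R)" "inj_on k (carrier B)"
    using B by (auto simp: rectangular_band_def is_iso_def iso_def bij_betw_def)
  have hS: "fst (h x) \<in> carrier G" "snd (h x) \<in> carrier B" if "x \<in> carrier S" for x
    using h(1) that by (force simp: hom_def)+
  have hm: "fst (h (x \<otimes>\<^bsub>S\<^esub> y)) = fst (h x) \<otimes>\<^bsub>G\<^esub> fst (h y)"
    "snd (h (x \<otimes>\<^bsub>S\<^esub> y)) = snd (h x) \<otimes>\<^bsub>B\<^esub> snd (h y)"
    if "x \<in> carrier S" "y \<in> carrier S" for x y
    using hom_mult[OF h(1) that] by (auto simp: DirProd_def split: prod.splits)
  have km: "k (x \<otimes>\<^bsub>B\<^esub> y) = (fst (k x), snd (k y))" if "x \<in> carrier B" "y \<in> carrier B" for x y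
    using hom_mult[OF k(1) that] by (simp add: band_product_def split: prod.splits)
  show ?thesis
  proof (rule supernilpotent_if_jointly_injective[OF S n G,
        where lp = "\<lambda>x. fst (k (snd (h x)))" and rp = "\<lambda>x. snd (k (snd (h x)))"])
    show "(\<lambda>x. fst (h x)) \<in> hom S G"
      using hS hm by (auto simp: hom_def)
    fix x y assume xy: "x \<in> carrier S" "y \<in> carrier S"
      and eq: "fst (h x) = fst (h y)" "fst (k (snd (h x))) = fst (k (snd (h y)))"
        "snd (k (snd (h x))) = snd (k (snd (h y)))"
    have "snd (h x) = snd (h y)"
      using inj_onD[OF k(2) prod_eqI[OF eq(2,3)]] xy hS by simp
    then show "x = y"
      using inj_onD[OF h(2) prod_eqI[OF eq(1)]] xy by simp
  qed (simp_all add: hm hS km)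
qed

section \<open>Idempotents of supernilpotent semigroups\<close>

text \<open>
The word \<open>e x\<^sub>0 e x\<^sub>1 e \<dots> e\<close>.
\<close>
primrec alternating_word :: "('a, 'm) monoid_scheme \<Rightarrow> 'a \<Rightarrow> nat \<Rightarrow> 'a list \<Rightarrow> 'a" where
  "alternating_word S e 0 = (\<lambda>v. e)"
| "alternating_word S e (Suc k) = (\<lambda>v. (alternating_word S e k v \<otimes>\<^bsub>S\<^esub> v ! k) \<otimes>\<^bsub>S\<^esub> e)"

lemma alternating_word_polynomial:
  assumes "e \<in> carrier S" "k \<le> N"
  shows "alternating_word S e k \<in> polynomials S N"
  using assms(2) by (induction k) (auto intro!: polynomials.intros assms(1))

text \<open>
The word \<open>e x\<^sub>0 e x\<^sub>1 e \<dots> e\<close> behaves like a meet on \<open>{e, f}\<close>: it has the value \<open>e f e\<close> as soon as one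
variable is \<open>f\<close>, because \<open>e f\<close> is idempotent, and the value \<open>e\<close> when all of them are \<open>e\<close>. So all
edges of the cube that avoid the top vertex are degenerate, and supernilpotence forces the last
one to be degenerate, too.
\<close>
lemma idempotent_sandwich:
  assumes S: "semigroup_struct S" and sn: "supernilpotent S n"
    and e: "e \<in> idempotents S" and f: "f \<in> idempotents S" and ef: "e \<otimes>\<^bsub>S\<^esub> f \<in> idempotents S"
  shows "e \<otimes>\<^bsub>S\<^esub> f \<otimes>\<^bsub>S\<^esub> e = e"
proof -
  interpret semigroup_struct S by (rule S)
  have carr: "e \<in> carrier S" "f \<in> carrier S"
    and idem: "e \<otimes>\<^bsub>S\<^esub> e = e" "e \<otimes>\<^bsub>S\<^esub> f \<otimes>\<^bsub>S\<^esub> (e \<otimes>\<^bsub>S\<^esub> f) = e \<otimes>\<^bsub>S\<^esub> f"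
    using e f ef by (auto simp: idempotents_def)
  let ?efe = "e \<otimes>\<^bsub>S\<^esub> f \<otimes>\<^bsub>S\<^esub> e"
  have step: "?efe \<otimes>\<^bsub>S\<^esub> e \<otimes>\<^bsub>S\<^esub> e = ?efe" "?efe \<otimes>\<^bsub>S\<^esub> f \<otimes>\<^bsub>S\<^esub> e = ?efe"
    using carr idem by (simp_all add: mult_closed mult_assoc)
  define u w where "u = (\<lambda>j::nat. [f])" and "w = (\<lambda>j::nat. [e])"
  have uw: "tuple_cube (carrier S) u w (Suc n)"
    using carr by (simp add: tuple_cube_def u_def w_def)
  have point: "cube_point u w m J = map (\<lambda>j. if j \<in> J then e else f) [0..<m]" for m J
    by (induction m) (auto simp: cube_point_def u_def w_def)
  have val: "alternating_word S e k (cube_point u w m J) = (if {..<k} \<subseteq> J then e else ?efe)"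
    if "k \<le> m" for k m J
    using that unfolding point
  proof (induction k)
    case (Suc k)
    then show ?case
      using idem(1) step by (auto simp: lessThan_Suc)
  qed simp
  have "alternating_word S e (Suc n) (cube_point u w (Suc n) {..<Suc n}) =
      alternating_word S e (Suc n) (cube_point u w (Suc n) {..<n})"
  proof (rule sn[unfolded supernilpotent_iff_cube[OF S], rule_format, OF uw])
    show "alternating_word S e (Suc n) \<in> polynomials S (\<Sum>j<Suc n. length (u j))"
      by (rule alternating_word_polynomial[OF carr(1)]) (simp add: u_def)
    fix J :: "nat set" assume "J \<subset> {..<n}"
    then obtain j where "j < n" "j \<notin> J" by auto
    then have "j \<in> {..<Suc n}" "j \<notin> insert n J" by auto
    then have "\<not> {..<Suc n} \<subseteq> insert n J" "\<not> {..<Suc n} \<subseteq> J"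
      by blast+
    then show "alternating_word S e (Suc n) (cube_point u w (Suc n) (insert n J)) =
        alternating_word S e (Suc n) (cube_point u w (Suc n) J)"
      unfolding val[OF order_refl] by simp
  qed
  then show ?thesis
    unfolding val[OF order_refl] by (simp add: lessThan_Suc)
qed

section \<open>Subgroups of supernilpotent semigroups\<close>

primrec upper_central :: "('a, 'm) monoid_scheme \<Rightarrow> nat \<Rightarrow> 'a set" where
  "upper_central G 0 = {\<one>\<^bsub>G\<^esub>}"
| "upper_central G (Suc k) =
    {z \<in> carrier G. \<forall>x\<in>carrier G. group.group_commutator G x z \<in> upper_central G k}"

primrec iterated_commutator :: "('a, 'm) monoid_scheme \<Rightarrow> (nat \<Rightarrow> 'a) \<Rightarrow> 'a \<Rightarrow> nat \<Rightarrow> 'a" where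
  "iterated_commutator G x y 0 = y"
| "iterated_commutator G x y (Suc k) = group.group_commutator G (x k) (iterated_commutator G x y k)"

text \<open>
The iterated commutator and its inverse as polynomials of a semigroup. Inverses are not available
as an operation, so each variable comes as a block of two letters, meant to be inverse to each
other, and the recursion builds the word for the inverse alongside. The innermost argument has
block index \<open>n\<close>.
\<close>
primrec commutator_word ::
  "('a, 'm) monoid_scheme \<Rightarrow> nat \<Rightarrow> nat \<Rightarrow> ('a list \<Rightarrow> 'a) \<times> ('a list \<Rightarrow> 'a)" where
  "commutator_word S n 0 = ((\<lambda>v. v ! (2 * n)), (\<lambda>v. v ! (2 * n + 1)))"
| "commutator_word S n (Suc k) =
    ((\<lambda>v. v ! (2 * k) \<otimes>\<^bsub>S\<^esub> fst (commutator_word S n k) v \<otimes>\<^bsub>S\<^esub> v ! (2 * k + 1)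
        \<otimes>\<^bsub>S\<^esub> snd (commutator_word S n k) v),
     (\<lambda>v. fst (commutator_word S n k) v \<otimes>\<^bsub>S\<^esub> v ! (2 * k) \<otimes>\<^bsub>S\<^esub> snd (commutator_word S n k) v
        \<otimes>\<^bsub>S\<^esub> v ! (2 * k + 1)))"

lemma commutator_word_polynomial:
  assumes "k \<le> n" "2 * n + 1 < N"
  shows "fst (commutator_word S n k) \<in> polynomials S N \<and> snd (commutator_word S n k) \<in> polynomials S N"
  using assms(1)
proof (induction k)
  case 0
  then show ?case using assms(2) by (auto intro!: polynomials.Var)
next
  case (Suc k)
  then show ?case using assms(2) by (auto intro!: polynomials.Var polynomials.Mult)
qed

context group
begin

lemma upper_central_normal: "upper_central G k \<lhd> G"
proof (induction k)
  case 0
  show ?case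
    by (auto simp: normal_inv_iff intro!: triv_subgroup)
next
  case (Suc k)
  note Z = normal.inv_op_closed1[OF Suc] normal.inv_op_closed2[OF Suc]
    subgroup.m_closed[OF normal_imp_subgroup[OF Suc]]
    subgroup.m_inv_closed[OF normal_imp_subgroup[OF Suc]]
    subgroup.one_closed[OF normal_imp_subgroup[OF Suc]]
  have "subgroup (upper_central G (Suc k)) G"
  proof (rule subgroupI)
    have "\<one> \<in> upper_central G (Suc k)"
      using Z(5) by (simp add: group_commutator_def)
    then show "upper_central G (Suc k) \<noteq> {}" by blast
  next
    fix a assume "a \<in> upper_central G (Suc k)"
    then show "inv a \<in> upper_central G (Suc k)"
      using Z(1,4) by (simp add: group_commutator_inv_right)
  next
    fix a b assume "a \<in> upper_central G (Suc k)" "b \<in> upper_central G (Suc k)"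
    then show "a \<otimes> b \<in> upper_central G (Suc k)"
      using Z(2,3) by (simp add: group_commutator_mult_right)
  qed auto
  moreover have "g \<otimes> z \<otimes> inv g \<in> upper_central G (Suc k)"
    if g: "g \<in> carrier G" and z: "z \<in> upper_central G (Suc k)" for g z
  proof -
    have "group_commutator x (g \<otimes> z \<otimes> inv g) = g \<otimes> group_commutator (inv g \<otimes> x \<otimes> g) z \<otimes> inv g"
      if "x \<in> carrier G" for x
      using that g z by (simp add: group_word_simps)
    then show ?thesis
      using g z Z(2) by simp
  qed
  ultimately show ?case
    by (simp add: normal_inv_iff)
qed

text \<open>
Commuting with the whole group moves down the lower central series by definition, and it moves
down the upper central series, too, whose terms are subgroups.
\<close>
lemma lower_central_subset_upper_central:
  assumes "carrier G = upper_central G n" "k \<le> n"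
  shows "lower_central G k \<subseteq> upper_central G (n - k)"
  using assms(2)
proof (induction k)
  case 0
  then show ?case using assms(1) by simp
next
  case (Suc k)
  then have nk: "n - k = Suc (n - Suc k)" by simp
  have IH: "lower_central G k \<subseteq> upper_central G (Suc (n - Suc k))"
    using Suc nk by simp
  show ?case
    unfolding lower_central.simps(2)
    by (rule generate_subgroup_incl[OF _ normal_imp_subgroup[OF upper_central_normal]])
      (use IH in \<open>auto simp flip: group_commutator_def\<close>)
qed

lemma iterated_commutator_cong:
  "(\<And>j. j < k \<Longrightarrow> x j = x' j) \<Longrightarrow> iterated_commutator G x y k = iterated_commutator G x' y k"
  by (induction k) auto

lemma iterated_commutator_closed:
  "\<lbrakk>\<And>j. x j \<in> carrier G; y \<in> carrier G\<rbrakk> \<Longrightarrow> iterated_commutator G x y k \<in> carrier G"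
  by (induction k) auto

lemma iterated_commutator_trivial:
  assumes x: "\<And>j. x j \<in> carrier G" and y: "y \<in> carrier G"
    and triv: "y = \<one> \<or> (\<exists>j<k. x j = \<one>)"
  shows "iterated_commutator G x y k = \<one>"
  using triv
proof (induction k)
  case (Suc k)
  have closed: "iterated_commutator G x y k \<in> carrier G"
    using x y by (rule iterated_commutator_closed)
  show ?case
  proof (cases "y = \<one> \<or> (\<exists>j<k. x j = \<one>)")
    case True
    then show ?thesis using Suc.IH x by (simp add: group_commutator_def)
  next
    case False
    then have "x k = \<one>" using Suc.prems by (auto simp: less_Suc_eq)
    then show ?thesis using closed by (simp add: group_commutator_def)
  qed
qed auto

text \<open>
The terms of the lower central series are generated by commutators with arbitrary elements of the
previous term and not only with iterated commutators. The upper central series bridges this gap: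
stripping the outermost entries, which are arbitrary, shows that an iterated commutator with \<open>d\<close>
entries missing lies in its \<open>d\<close>-th term; for \<open>d = n\<close> this says that the series reaches the whole
group.
\<close>
lemma nilpotent_if_iterated_commutators_trivial:
  assumes triv: "\<And>x y. \<lbrakk>\<And>j. x j \<in> carrier G; y \<in> carrier G\<rbrakk> \<Longrightarrow> iterated_commutator G x y n = \<one>"
  shows "nilpotent_group G n"
proof -
  have upper: "iterated_commutator G x y (n - d) \<in> upper_central G d"
    if "\<And>j. x j \<in> carrier G" "y \<in> carrier G" "d \<le> n" for x y d
    using that
  proof (induction d arbitrary: x)
    case 0
    then show ?case using triv by simp
  next
    case (Suc d)
    let ?k = "n - Suc d"
    have k: "n - d = Suc ?k" using Suc.prems by simp
    \<comment> \<open>The entry \<open>x ?k\<close> does not occur in the inner commutator and may be replaced.\<close>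
    have "group_commutator g (iterated_commutator G x y ?k) \<in> upper_central G d"
      if g: "g \<in> carrier G" for g
    proof -
      have "iterated_commutator G (x(?k := g)) y (n - d) =
          group_commutator g (iterated_commutator G x y ?k)"
        unfolding k using iterated_commutator_cong[of ?k x "x(?k := g)" y] by simp
      moreover have "iterated_commutator G (x(?k := g)) y (n - d) \<in> upper_central G d"
        by (rule Suc.IH) (use Suc.prems g in auto)
      ultimately show ?thesis by simp
    qed
    then show ?case
      using iterated_commutator_closed Suc.prems by simp
  qed
  have "carrier G = upper_central G n"
  proof
    show "carrier G \<subseteq> upper_central G n"
      using upper[of "\<lambda>j. \<one>" _ n] by auto
    show "upper_central G n \<subseteq> carrier G"
      using normal_imp_subgroup[OF upper_central_normal] by (rule subgroup.subset)
  qed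
  then have "lower_central G n \<subseteq> {\<one>}"
    using lower_central_subset_upper_central[of n n] by simp
  then show ?thesis
    using subgroup.one_closed[OF lower_central_subgroup, of n] group_axioms
    by (auto simp: nilpotent_group_def)
qed

end

text \<open>
An iterated commutator is trivial as soon as one of its entries is. On the cube whose blocks move
from \<open>(1, 1)\<close> to \<open>(x, x\<inverse>)\<close>, its value is therefore trivial at all vertices except possibly the
top one, and supernilpotence makes it trivial there.
\<close>
lemma nilpotent_if_embedded_in_supernilpotent:
  assumes S: "semigroup_struct S" and sn: "supernilpotent S n" and G: "group G"
    and sub: "carrier G \<subseteq> carrier S"
    and mult: "\<And>x y. \<lbrakk>x \<in> carrier G; y \<in> carrier G\<rbrakk> \<Longrightarrow> x \<otimes>\<^bsub>S\<^esub> y = x \<otimes>\<^bsub>G\<^esub> y"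
  shows "nilpotent_group G n"
proof -
  interpret G: group G by (rule G)
  show ?thesis
  proof (rule G.nilpotent_if_iterated_commutators_trivial)
    fix x y assume x: "\<And>j::nat. x j \<in> carrier G" and y: "y \<in> carrier G"
    define x' where "x' = x(n := y)"
    have x': "x' j \<in> carrier G" for j using x y by (simp add: x'_def)
    define u w where "u = (\<lambda>j::nat. [\<one>\<^bsub>G\<^esub>, \<one>\<^bsub>G\<^esub>])" and "w = (\<lambda>j. [x' j, inv\<^bsub>G\<^esub> x' j])"
    define z where "z = (\<lambda>J j. if j \<in> J then x' j else \<one>\<^bsub>G\<^esub>)"
    have z: "z J j \<in> carrier G" for J j using x' by (simp add: z_def)
    have uw: "tuple_cube (carrier S) u w (Suc n)"
      using x' sub by (auto simp: tuple_cube_def u_def w_def)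
    have nth: "cube_point u w m J ! (2 * j) = z J j \<and>
        cube_point u w m J ! (2 * j + 1) = inv\<^bsub>G\<^esub> z J j" if "j < m" for j m J
      using that
    proof (induction m)
      case (Suc m)
      have "length (cube_point u w m J) = 2 * m"
        by (induction m) (auto simp: cube_point_Suc u_def w_def, simp add: cube_point_def)
      then show ?case
        using Suc by (cases "j = m") (auto simp: cube_point_Suc nth_append z_def u_def w_def)
    qed simp
    have val: "fst (commutator_word S n k) (cube_point u w (Suc n) J) =
          iterated_commutator G (z J) (z J n) k \<and>
        snd (commutator_word S n k) (cube_point u w (Suc n) J) =
          inv\<^bsub>G\<^esub> iterated_commutator G (z J) (z J n) k" if "k \<le> n" for k J
      using that
    proof (induction k)
      case 0
      then show ?case using nth[of n "Suc n"] by simp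
    next
      case (Suc k)
      have "iterated_commutator G (z J) (z J n) k \<in> carrier G"
        by (rule G.iterated_commutator_closed) (rule z)+
      then show ?case
        using Suc nth[of k "Suc n"] z[of J k]
        by (simp add: mult G.group_commutator_def G.inv_mult_group G.m_assoc)
    qed
    define p where "p = fst (commutator_word S n n)"
    have p: "p \<in> polynomials S (\<Sum>j<Suc n. length (u j))"
      unfolding p_def using commutator_word_polynomial[of n n "2 * n + 2" S] by (simp add: u_def mult_2)
    have pval: "p (cube_point u w (Suc n) J) = iterated_commutator G (z J) (z J n) n" for J
      using val[of n J] by (simp add: p_def)
    have "p (cube_point u w (Suc n) {..<Suc n}) = p (cube_point u w (Suc n) {..<n})"
    proof (rule sn[unfolded supernilpotent_iff_cube[OF S], rule_format, OF uw p])
      fix J :: "nat set" assume "J \<subset> {..<n}"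
      then obtain j where "j < n" "j \<notin> J" by auto
      then have "z (insert n J) j = \<one>\<^bsub>G\<^esub>" "z J j = \<one>\<^bsub>G\<^esub>"
        by (auto simp: z_def)
      then have "p (cube_point u w (Suc n) (insert n J)) = \<one>\<^bsub>G\<^esub>"
        "p (cube_point u w (Suc n) J) = \<one>\<^bsub>G\<^esub>"
        unfolding pval using \<open>j < n\<close> by (intro G.iterated_commutator_trivial[OF z z]; blast)+
      then show "p (cube_point u w (Suc n) (insert n J)) = p (cube_point u w (Suc n) J)"
        by simp
    qed
    also have "\<dots> = \<one>\<^bsub>G\<^esub>"
      unfolding pval by (rule G.iterated_commutator_trivial[OF z z]) (simp add: z_def)
    finally have "iterated_commutator G (z {..<Suc n}) (z {..<Suc n} n) n = \<one>\<^bsub>G\<^esub>"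
      unfolding pval .
    moreover have "iterated_commutator G (z {..<Suc n}) y n = iterated_commutator G x y n"
      by (rule G.iterated_commutator_cong) (simp add: z_def x'_def)
    ultimately show "iterated_commutator G x y n = \<one>\<^bsub>G\<^esub>"
      by (simp add: z_def x'_def)
  qed
qed

section \<open>Decomposition of orthodox semigroups\<close>

text \<open>
The monoid \<open>e S e\<close>, described by the elements on which \<open>e\<close> acts as a two-sided identity.
\<close>
definition local_monoid :: "('a, 'm) monoid_scheme \<Rightarrow> 'a \<Rightarrow> 'a monoid" where
  "local_monoid S e = \<lparr>carrier = {x \<in> carrier S. e \<otimes>\<^bsub>S\<^esub> x = x \<and> x \<otimes>\<^bsub>S\<^esub> e = x},
     mult = (\<otimes>\<^bsub>S\<^esub>), one = e\<rparr>"

context orthodox_semigroup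
begin

lemma mult_left_rewrite:
  assumes "x \<otimes> y = w" "x \<in> carrier S" "y \<in> carrier S" "z \<in> carrier S"
  shows "x \<otimes> (y \<otimes> z) = w \<otimes> z"
  using assms by (simp flip: mult_assoc)

lemma regular_idempotents:
  assumes x: "x \<in> carrier S" and y: "y \<in> carrier S" and xyx: "x \<otimes> y \<otimes> x = x"
  shows "x \<otimes> y \<in> idempotents S" "y \<otimes> x \<in> idempotents S"
proof -
  have "x \<otimes> y \<otimes> (x \<otimes> y) = (x \<otimes> y \<otimes> x) \<otimes> y" "y \<otimes> x \<otimes> (y \<otimes> x) = y \<otimes> (x \<otimes> y \<otimes> x)"
    using x y by (simp_all add: mult_assoc mult_closed)
  then show "x \<otimes> y \<in> idempotents S" "y \<otimes> x \<in> idempotents S"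
    using x y xyx by (simp_all add: idempotents_def mult_closed)
qed

text \<open>
For \<open>x\<close> in \<open>e S e\<close> with \<open>x y x = x\<close>, the element \<open>e y e\<close> is a left inverse: \<open>e y e x\<close> is
\<open>e (y x) e\<close>, and this equals \<open>e\<close> because \<open>y x\<close> is idempotent.
\<close>
lemma local_monoid_group:
  assumes e: "e \<in> idempotents S"
    and sandwich: "\<And>f. f \<in> idempotents S \<Longrightarrow> e \<otimes> f \<otimes> e = e"
  shows "group (local_monoid S e)"
proof (rule groupI)
  have ee: "e \<in> carrier S" "e \<otimes> e = e" using e by (auto simp: idempotents_def)
  show "\<one>\<^bsub>local_monoid S e\<^esub> \<in> carrier (local_monoid S e)"
    using ee by (simp add: local_monoid_def)
  fix x assume x: "x \<in> carrier (local_monoid S e)"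
  then show "\<one>\<^bsub>local_monoid S e\<^esub> \<otimes>\<^bsub>local_monoid S e\<^esub> x = x"
    by (simp add: local_monoid_def)
  have x: "x \<in> carrier S" "e \<otimes> x = x" "x \<otimes> e = x" using x by (auto simp: local_monoid_def)
  obtain y where y: "y \<in> carrier S" "x \<otimes> y \<otimes> x = x" using regular[OF x(1)] by blast
  have "e \<otimes> (y \<otimes> x) \<otimes> e = e"
    by (rule sandwich[OF regular_idempotents(2)[OF x(1) y]])
  moreover have "e \<otimes> (y \<otimes> x) \<otimes> e = e \<otimes> y \<otimes> e \<otimes> x"
    using x y ee by (simp add: mult_assoc mult_closed)
  moreover have "e \<otimes> y \<otimes> e \<in> carrier (local_monoid S e)"
    using y(1) ee
    by (simp add: local_monoid_def mult_closed mult_assoc mult_left_rewrite[OF ee(2)])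
  ultimately show "\<exists>y\<in>carrier (local_monoid S e). y \<otimes>\<^bsub>local_monoid S e\<^esub> x = \<one>\<^bsub>local_monoid S e\<^esub>"
    by (auto simp: local_monoid_def)
next
  fix x y assume "x \<in> carrier (local_monoid S e)" "y \<in> carrier (local_monoid S e)"
  then show "x \<otimes>\<^bsub>local_monoid S e\<^esub> y \<in> carrier (local_monoid S e)"
    using e by (auto simp: local_monoid_def idempotents_def mult_closed mult_assoc)
      (simp flip: mult_assoc)
next
  fix x y z
  assume "x \<in> carrier (local_monoid S e)" "y \<in> carrier (local_monoid S e)"
    "z \<in> carrier (local_monoid S e)"
  then show "x \<otimes>\<^bsub>local_monoid S e\<^esub> y \<otimes>\<^bsub>local_monoid S e\<^esub> z =
      x \<otimes>\<^bsub>local_monoid S e\<^esub> (y \<otimes>\<^bsub>local_monoid S e\<^esub> z)"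
    by (simp add: local_monoid_def mult_assoc)
qed

text \<open>
The condition \<open>e f e = e\<close> for all idempotents makes \<open>r l = e\<close> whenever \<open>l e = l\<close> and \<open>e r = r\<close>, which
turns \<open>(g, l, r) \<mapsto> l g r\<close> into a homomorphism from the direct product. The factors can be read
off from \<open>x = l g r\<close> as \<open>g = e x e\<close>, \<open>l = x g\<inverse>\<close> and \<open>r = g\<inverse> x\<close>. Conversely, an element \<open>x\<close> with
\<open>x y x = x\<close> is the product of \<open>x y e\<close>, \<open>e x e\<close> and \<open>e y x\<close>: the idempotents \<open>x y\<close> and \<open>y x\<close> satisfy
\<open>(x y) e (x y) = x y\<close> and \<open>(y x) e (y x) = y x\<close>, so that the inner occurrences of \<open>e\<close> cancel.
\<close>
lemma iso_local_group_times_band: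
  assumes e: "e \<in> idempotents S"
    and sandwich: "\<And>e f. \<lbrakk>e \<in> idempotents S; f \<in> idempotents S\<rbrakk> \<Longrightarrow> e \<otimes> f \<otimes> e = e"
  defines "L \<equiv> {l \<in> idempotents S. l \<otimes> e = l}" and "R \<equiv> {r \<in> idempotents S. e \<otimes> r = r}"
  shows "(\<lambda>(g, l, r). l \<otimes> g \<otimes> r) \<in> iso (local_monoid S e \<times>\<times> band_product L R) S"
proof -
  have ee: "e \<in> carrier S" "e \<otimes> e = e" using e by (auto simp: idempotents_def)
  interpret G: group "local_monoid S e"
    using local_monoid_group[OF e] sandwich[OF e] by blast
  let ?G = "carrier (local_monoid S e)"
  have lm: "x \<otimes>\<^bsub>local_monoid S e\<^esub> y = x \<otimes> y" "\<one>\<^bsub>local_monoid S e\<^esub> = e" for x y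
    by (simp_all add: local_monoid_def)
  have g: "g \<in> carrier S" "e \<otimes> g = g" "g \<otimes> e = g" if "g \<in> ?G" for g
    using that by (auto simp: local_monoid_def)
  have l: "l \<in> carrier S" "l \<in> idempotents S" "l \<otimes> e = l" "e \<otimes> l = e" if "l \<in> L" for l
    using that sandwich[OF e, of l] ee by (auto simp: L_def idempotents_def mult_assoc)
  have r: "r \<in> carrier S" "r \<in> idempotents S" "e \<otimes> r = r" "r \<otimes> e = e" if "r \<in> R" for r
    using that sandwich[OF e, of r] ee by (auto simp: R_def idempotents_def mult_assoc)
  have rl: "r \<otimes> l = e" if "r \<in> R" "l \<in> L" for r l
  proof -
    have "e \<otimes> (r \<otimes> l) \<otimes> e = e"
      by (rule sandwich[OF e idempotents_closed]) (use l r that in auto)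
    moreover have "e \<otimes> (r \<otimes> l) \<otimes> e = (e \<otimes> r) \<otimes> (l \<otimes> e)"
      using r(1)[OF that(1)] l(1)[OF that(2)] ee(1) by (simp add: mult_assoc mult_closed)
    moreover have "l \<otimes> e = l" "e \<otimes> r = r" using that l r by blast+
    ultimately show ?thesis by simp
  qed
  have hom: "l \<otimes> g \<otimes> r \<otimes> (l' \<otimes> g' \<otimes> r') = l \<otimes> (g \<otimes> g') \<otimes> r'"
    if "g \<in> ?G" "l \<in> L" "r \<in> R" "g' \<in> ?G" "l' \<in> L" "r' \<in> R" for g l r g' l' r'
  proof -
    have "l \<otimes> g \<otimes> r \<otimes> (l' \<otimes> g' \<otimes> r') = l \<otimes> (g \<otimes> (r \<otimes> l') \<otimes> g') \<otimes> r'"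
      using g(1)[OF that(1)] l(1)[OF that(2)] r(1)[OF that(3)]
        g(1)[OF that(4)] l(1)[OF that(5)] r(1)[OF that(6)]
      by (simp add: mult_assoc mult_closed)
    then show ?thesis using rl[OF that(3,5)] g(3)[OF that(1)] by simp
  qed
  have inj: "g = g' \<and> l = l' \<and> r = r'"
    if "g \<in> ?G" "l \<in> L" "r \<in> R" "g' \<in> ?G" "l' \<in> L" "r' \<in> R"
      and eq: "l \<otimes> g \<otimes> r = l' \<otimes> g' \<otimes> r'" for g l r g' l' r'
  proof -
    have core: "e \<otimes> (l \<otimes> g \<otimes> r) \<otimes> e = g" "l \<otimes> g \<otimes> r \<otimes> inv\<^bsub>local_monoid S e\<^esub> g = l"
      "inv\<^bsub>local_monoid S e\<^esub> g \<otimes> (l \<otimes> g \<otimes> r) = r" if mem: "g \<in> ?G" "l \<in> L" "r \<in> R" for g l r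
    proof -
      let ?i = "inv\<^bsub>local_monoid S e\<^esub> g"
      have i: "?i \<in> ?G" "g \<otimes> ?i = e" "?i \<otimes> g = e"
        using mem(1) G.r_inv[OF mem(1)] G.l_inv[OF mem(1)] by (simp_all add: lm)
      note c = g(1)[OF mem(1)] l(1)[OF mem(2)] r(1)[OF mem(3)] g(1)[OF i(1)]
      note a = g[OF mem(1)] l(3,4)[OF mem(2)] r(3,4)[OF mem(3)]
      have ri: "r \<otimes> ?i = ?i"
        using mult_left_rewrite[OF r(4)[OF mem(3)] c(3) ee(1) c(4)] g(2)[OF i(1)] by simp
      have il: "?i \<otimes> l = ?i"
        using mult_assoc[OF c(4) ee(1) c(2)] g(3)[OF i(1)] l(4)[OF mem(2)] by simp
      have "e \<otimes> (l \<otimes> g \<otimes> r) \<otimes> e = (e \<otimes> l) \<otimes> g \<otimes> (r \<otimes> e)"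
        using c ee(1) by (simp add: mult_assoc mult_closed)
      then show "e \<otimes> (l \<otimes> g \<otimes> r) \<otimes> e = g" using a by simp
      have "l \<otimes> g \<otimes> r \<otimes> ?i = l \<otimes> (g \<otimes> (r \<otimes> ?i))"
        using c by (simp add: mult_assoc mult_closed)
      then show "l \<otimes> g \<otimes> r \<otimes> ?i = l" using a i ri by simp
      have "?i \<otimes> (l \<otimes> g \<otimes> r) = (?i \<otimes> l) \<otimes> g \<otimes> r"
        using c by (simp add: mult_assoc mult_closed)
      then show "?i \<otimes> (l \<otimes> g \<otimes> r) = r" using a i il by simp
    qed
    have gg: "g = g'"
      using core(1)[OF that(1-3)] core(1)[OF that(4-6)] eq by simp
    then show ?thesis
      using core(2,3)[OF that(1-3)] core(2,3)[OF that(4-6)] eq by simp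
  qed
  have surj: "\<exists>g\<in>?G. \<exists>l\<in>L. \<exists>r\<in>R. x = l \<otimes> g \<otimes> r" if x: "x \<in> carrier S" for x
  proof -
    obtain y where y: "y \<in> carrier S" "x \<otimes> y \<otimes> x = x" using regular[OF x] by blast
    note f = regular_idempotents[OF x y]
    show ?thesis
    proof (intro bexI)
      show "e \<otimes> x \<otimes> e \<in> ?G"
        using x ee
        by (simp add: local_monoid_def mult_closed mult_assoc mult_left_rewrite[OF ee(2)])
      show "x \<otimes> y \<otimes> e \<in> L"
        using idempotents_closed[OF f(1) e] x y(1) ee by (simp add: L_def mult_closed mult_assoc)
      show "e \<otimes> (y \<otimes> x) \<in> R"
        using idempotents_closed[OF e f(2)] x y(1) ee
        by (simp add: R_def mult_closed flip: mult_assoc)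
      have 1: "x \<otimes> y \<otimes> e \<otimes> x = x"
      proof -
        have "x \<otimes> y \<otimes> e \<otimes> x = x \<otimes> y \<otimes> e \<otimes> (x \<otimes> y \<otimes> x)" using y by simp
        also have "\<dots> = (x \<otimes> y \<otimes> e \<otimes> (x \<otimes> y)) \<otimes> x"
          using x y(1) ee(1) by (simp add: mult_assoc mult_closed)
        finally show ?thesis using sandwich[OF f(1) e] y by simp
      qed
      have 2: "x \<otimes> e \<otimes> (y \<otimes> x) = x"
      proof -
        have "x \<otimes> e \<otimes> (y \<otimes> x) = (x \<otimes> y \<otimes> x) \<otimes> e \<otimes> (y \<otimes> x)" using y by simp
        also have "\<dots> = x \<otimes> (y \<otimes> x \<otimes> e \<otimes> (y \<otimes> x))"
          using x y(1) ee(1) by (simp add: mult_assoc mult_closed)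
        also have "\<dots> = x \<otimes> (y \<otimes> x)" using sandwich[OF f(2) e] by simp
        finally show ?thesis using x y by (simp add: mult_assoc)
      qed
      have "x \<otimes> y \<otimes> e \<otimes> (e \<otimes> x \<otimes> e) \<otimes> (e \<otimes> (y \<otimes> x))
          = (x \<otimes> y \<otimes> (e \<otimes> e) \<otimes> x) \<otimes> (e \<otimes> e) \<otimes> (y \<otimes> x)"
        using x y(1) ee(1) by (simp add: mult_assoc mult_closed)
      then show "x = x \<otimes> y \<otimes> e \<otimes> (e \<otimes> x \<otimes> e) \<otimes> (e \<otimes> (y \<otimes> x))"
        using 1 2 ee by simp
    qed
  qed
  have closed: "l \<otimes> g \<otimes> r \<in> carrier S" if "g \<in> ?G" "l \<in> L" "r \<in> R" for g l r
    using g(1) l(1) r(1) that by (simp add: mult_closed)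
  show ?thesis
    unfolding iso_def
  proof (intro CollectI conjI)
    show "(\<lambda>(g, l, r). l \<otimes> g \<otimes> r) \<in> hom (local_monoid S e \<times>\<times> band_product L R) S"
      using closed hom by (auto simp: hom_def band_product_def local_monoid_def)
    show "bij_betw (\<lambda>(g, l, r). l \<otimes> g \<otimes> r)
        (carrier (local_monoid S e \<times>\<times> band_product L R)) (carrier S)"
    proof (rule bij_betw_imageI)
      show "inj_on (\<lambda>(g, l, r). l \<otimes> g \<otimes> r) (carrier (local_monoid S e \<times>\<times> band_product L R))"
        using inj by (auto simp: inj_on_def band_product_def)
      show "(\<lambda>(g, l, r). l \<otimes> g \<otimes> r) ` carrier (local_monoid S e \<times>\<times> band_product L R) = carrier S"
        using closed surj by (force simp: band_product_def)
    qed
  qed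
qed

lemma ex_idempotent: "\<exists>e. e \<in> idempotents S"
proof -
  obtain x where x: "x \<in> carrier S" using carrier_nonempty by blast
  then obtain y where "y \<in> carrier S" "x \<otimes> y \<otimes> x = x" using regular by blast
  then show ?thesis using regular_idempotents(1)[OF x] by blast
qed

lemma iso_group_times_band_if_supernilpotent:
  assumes sn: "supernilpotent S n"
  shows "\<exists>(G :: 'a monoid) (B :: 'a monoid).
    nilpotent_group G n \<and> rectangular_band B \<and> S \<cong> G \<times>\<times> B"
proof -
  obtain e where e: "e \<in> idempotents S" using ex_idempotent by blast
  have sandwich: "e \<otimes> f \<otimes> e = e" if "e \<in> idempotents S" "f \<in> idempotents S" for e f
    by (rule idempotent_sandwich[OF semigroup_struct_axioms sn that idempotents_closed[OF that]])
  let ?G = "local_monoid S e"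
  define L R where "L = {l \<in> idempotents S. l \<otimes> e = l}" and "R = {r \<in> idempotents S. e \<otimes> r = r}"
  have G: "group ?G"
    by (rule local_monoid_group[OF e sandwich[OF e]])
  have "nilpotent_group ?G n"
    by (rule nilpotent_if_embedded_in_supernilpotent[OF semigroup_struct_axioms sn G])
      (auto simp: local_monoid_def)
  moreover have "rectangular_band (band_product L R)"
  proof (rule rectangular_band_if_iso_band_product)
    show "L \<noteq> {}" "R \<noteq> {}" using e by (auto simp: L_def R_def idempotents_def)
    show "band_product L R \<cong> band_product L R" by (rule iso_refl)
  qed
  moreover have "(\<lambda>(g, l, r). l \<otimes> g \<otimes> r) \<in> iso (?G \<times>\<times> band_product L R) S"
    unfolding L_def R_def by (rule iso_local_group_times_band[OF e sandwich])
  then have "inv_into (carrier (?G \<times>\<times> band_product L R)) (\<lambda>(g, l, r). l \<otimes> g \<otimes> r)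
      \<in> iso S (?G \<times>\<times> band_product L R)"
    by (rule inverse_iso) (use monoid.m_closed[OF group.is_monoid[OF G]] in
        \<open>auto simp: band_product_def\<close>)
  then have "S \<cong> ?G \<times>\<times> band_product L R"
    by (auto simp: is_iso_def)
  ultimately show ?thesis
    by (rule factors_over_own_type[OF semigroup_struct_axioms])
qed

end

theorem theorem4p6:
  fixes S :: "('a, 'm) monoid_scheme" and n :: nat
  assumes "orthodox_semigroup S" and "1 \<le> n"
  shows "supernilpotent S n \<longleftrightarrow>
    (\<exists>(G :: 'a monoid) (B :: 'a monoid).
       nilpotent_group G n \<and> rectangular_band B \<and> S \<cong> G \<times>\<times> B)"
proof -
  interpret orthodox_semigroup S by (rule assms(1))
  show ?thesis
  proof
    assume "supernilpotent S n"
    then show "\<exists>(G :: 'a monoid) (B :: 'a monoid).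
        nilpotent_group G n \<and> rectangular_band B \<and> S \<cong> G \<times>\<times> B"
      by (rule iso_group_times_band_if_supernilpotent)
  next
    assume "\<exists>(G :: 'a monoid) (B :: 'a monoid).
        nilpotent_group G n \<and> rectangular_band B \<and> S \<cong> G \<times>\<times> B"
    then show "supernilpotent S n"
      by (elim exE conjE) (rule supernilpotent_if_iso_group_times_band[OF semigroup_struct_axioms assms(2)])
  qed
qed

end
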